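(* Let $\mathbb{K}$ be a field of characteristic zero, $V$ a $\mathbb{K}$-vector space of finite dimension $n\ge2$, $\mathfrak{L},\mathfrak{L}'\subseteq\mathfrak{gl}_{\mathbb{K}}(V)$ Lie subalgebras and $\mathcal{K},\mathcal{K}'$ two cofinite $\mathbb{Z}$-graded ideals of $\mathfrak{f}(V)$ contained in $\mathfrak{f}_{[2]}(V)$. Assume that $\mathfrak{L}\subseteq\mathfrak{L}'$ and $\mathcal{K}\subseteq\mathcal{K}'$. Then $\mathfrak{g}(\mathcal{K},\mathfrak{L})$ is finite dimensional if $\mathfrak{g}(\mathcal{K}',\mathfrak{L}')$ is finite dimensional, and $\mathfrak{g}(\mathcal{K}',\mathfrak{L}')$ is infinite dimensional if $\mathfrak{g}(\mathcal{K},\mathfrak{L})$ is infinite dimensional.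
   Context: $\mathfrak{f}(V)=\sum_{p\ge1}\mathfrak{f}_{-p}(V)$ is the free Lie $\mathbb{K}$-algebra generated by $V$, graded so that $\mathfrak{f}_{-1}(V)=V$; $\mathfrak{f}_{[q]}(V)=\sum_{p\ge q}\mathfrak{f}_{-p}(V)$. An ideal $\mathcal{K}$ of $\mathfrak{f}(V)$ is cofinite if $\mathfrak{f}_{[\mu+1]}(V)\subseteq\mathcal{K}$ for some integer $\mu\ge1$. For a graded ideal $\mathcal{K}\subseteq\mathfrak{f}_{[2]}(V)$, $\mathfrak{m}(\mathcal{K})=\mathfrak{f}(V)/\mathcal{K}$, with degree $-1$ part $V$. A $\mathbb{Z}$-graded Lie algebra $\mathfrak{g}=\sum_{p\in\mathbb{Z}}\mathfrak{g}_p$ is an effective prolongation of $\mathfrak{m}(\mathcal{K})$ if $\sum_{p<0}\mathfrak{g}_p=\mathfrak{m}(\mathcal{K})$ and $\{X\in\sum_{p\ge0}\mathfrak{g}_p\mid[X,\mathfrak{g}_{-1}]=\{0\}\}=\{0\}$. It is of type $\mathfrak{L}$ if for each $A\in\mathfrak{g}_0$ the map $v\mapsto[A,v]$ on $\mathfrak{g}_{-1}=V$ belongs to $\mathfrak{L}$. $\mathfrak{g}(\mathcal{K},\mathfrak{L})$ denotes the maximal effective prolongation of type $\mathfrak{L}$ of $\mathfrak{m}(\mathcal{K})$, i.e. the one (which exists and is unique up to isomorphism) into which every effective prolongation of type $\mathfrak{L}$ of $\mathfrak{m}(\mathcal{K})$ embeds by an injective graded Lie algebra homomorphism that is the identity on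 $\mathfrak{m}(\mathcal{K})$. *)

theory Defs
  imports Complex_Main "HOL-Computational_Algebra.Polynomial"
begin

section \<open>Lie algebras\<close>

text \<open>
  A Lie algebra lives on a subspace \<open>carrier\<close> of an ambient vector space: the addition is that of
  the type \<^typ>\<open>'a\<close>, and the bracket is only meaningful on the carrier.
\<close>

record ('k, 'a) lie_alg =
  carrier :: "'a set"
  smul :: "'k \<Rightarrow> 'a \<Rightarrow> 'a"
  bracket :: "'a \<Rightarrow> 'a \<Rightarrow> 'a"

definition lie_algebra :: "('k::field, 'a::ab_group_add, 'm) lie_alg_scheme \<Rightarrow> bool" where
  "lie_algebra g \<longleftrightarrow>
     vector_space (smul g) \<and> module.subspace (smul g) (carrier g) \<and>
     (\<forall>x\<in>carrier g. \<forall>y\<in>carrier g. bracket g x y \<in> carrier g) \<and>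
     (\<forall>x\<in>carrier g. \<forall>y\<in>carrier g. \<forall>z\<in>carrier g.
        bracket g (x + y) z = bracket g x z + bracket g y z \<and>
        bracket g x (y + z) = bracket g x y + bracket g x z) \<and>
     (\<forall>c. \<forall>x\<in>carrier g. \<forall>y\<in>carrier g.
        bracket g (smul g c x) y = smul g c (bracket g x y) \<and>
        bracket g x (smul g c y) = smul g c (bracket g x y)) \<and>
     (\<forall>x\<in>carrier g. bracket g x x = 0) \<and>
     (\<forall>x\<in>carrier g. \<forall>y\<in>carrier g. \<forall>z\<in>carrier g.
        bracket g x (bracket g y z) + bracket g y (bracket g z x) + bracket g z (bracket g x y) = 0)"

definition fin_dim :: "('k::field, 'a::ab_group_add, 'm) lie_alg_scheme \<Rightarrow> bool" where
  "fin_dim g \<longleftrightarrow> (\<exists>B. finite B \<and> module.span (smul g) B = carrier g)"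

definition lie_hom ::
  "('k::field, 'a::ab_group_add, 'm) lie_alg_scheme \<Rightarrow> ('k, 'b::ab_group_add, 'n) lie_alg_scheme \<Rightarrow>
   ('a \<Rightarrow> 'b) \<Rightarrow> bool" where
  "lie_hom g h \<phi> \<longleftrightarrow>
     \<phi> ` carrier g \<subseteq> carrier h \<and>
     (\<forall>x\<in>carrier g. \<forall>y\<in>carrier g. \<phi> (x + y) = \<phi> x + \<phi> y) \<and>
     (\<forall>c. \<forall>x\<in>carrier g. \<phi> (smul g c x) = smul h c (\<phi> x)) \<and>
     (\<forall>x\<in>carrier g. \<forall>y\<in>carrier g. \<phi> (bracket g x y) = bracket h (\<phi> x) (\<phi> y))"

definition lie_ideal :: "('k::field, 'a::ab_group_add, 'm) lie_alg_scheme \<Rightarrow> 'a set \<Rightarrow> bool" where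
  "lie_ideal g K \<longleftrightarrow>
     module.subspace (smul g) K \<and> K \<subseteq> carrier g \<and>
     (\<forall>x\<in>carrier g. \<forall>y\<in>K. bracket g x y \<in> K)"

definition lie_subalgebra_gl :: "('k::field \<Rightarrow> 'v::ab_group_add \<Rightarrow> 'v) \<Rightarrow> ('v \<Rightarrow> 'v) set \<Rightarrow> bool" where
  "lie_subalgebra_gl sV L \<longleftrightarrow>
     (\<forall>A\<in>L. Vector_Spaces.linear sV sV A) \<and>
     (\<lambda>v. 0) \<in> L \<and>
     (\<forall>A\<in>L. \<forall>B\<in>L. (\<lambda>v. A v + B v) \<in> L) \<and>
     (\<forall>c. \<forall>A\<in>L. (\<lambda>v. sV c (A v)) \<in> L) \<and>
     (\<forall>A\<in>L. \<forall>B\<in>L. (\<lambda>v. A (B v) - B (A v)) \<in> L)"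


section \<open>Graded Lie algebras\<close>

record ('k, 'a) graded_lie_alg = "('k, 'a) lie_alg" +
  component :: "int \<Rightarrow> 'a set"

definition component_sum ::
  "('k::field, 'a::ab_group_add, 'm) graded_lie_alg_scheme \<Rightarrow> int set \<Rightarrow> 'a set" where
  "component_sum g P = module.span (smul g) (\<Union>p\<in>P. component g p)"

definition graded_lie_algebra ::
  "('k::field, 'a::ab_group_add, 'm) graded_lie_alg_scheme \<Rightarrow> bool" where
  "graded_lie_algebra g \<longleftrightarrow>
     lie_algebra g \<and>
     (\<forall>p. module.subspace (smul g) (component g p)) \<and>
     carrier g = component_sum g UNIV \<and>
     (\<forall>P x. finite P \<and> (\<forall>p\<in>P. x p \<in> component g p) \<and> (\<Sum>p\<in>P. x p) = 0 \<longrightarrow> (\<forall>p\<in>P. x p = 0)) \<and>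
     (\<forall>p q. \<forall>x\<in>component g p. \<forall>y\<in>component g q. bracket g x y \<in> component g (p + q))"

definition graded_lie_ideal ::
  "('k::field, 'a::ab_group_add, 'm) graded_lie_alg_scheme \<Rightarrow> 'a set \<Rightarrow> bool" where
  "graded_lie_ideal g K \<longleftrightarrow>
     lie_ideal g K \<and> K = module.span (smul g) (\<Union>p. K \<inter> component g p)"

definition negative_part :: "('k::field, 'a::ab_group_add) graded_lie_alg \<Rightarrow> ('k, 'a) graded_lie_alg" where
  "negative_part g = g\<lparr>carrier := component_sum g {..<0},
                       component := (\<lambda>p. if p < 0 then component g p else {0})\<rparr>"

text \<open>
  \<open>is_graded_quotient g K m \<pi>\<close>: the graded Lie algebra \<open>m\<close> is the quotient of \<open>g\<close> by \<open>K\<close>, with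
  projection \<open>\<pi>\<close>. Quotients are only considered up to the canonical isomorphism, so that \<open>\<pi>\<close>
  stands for the identification of \<open>m\<close> with the set of cosets.
\<close>

definition is_graded_quotient ::
  "('k::field, 'f::ab_group_add) graded_lie_alg \<Rightarrow> 'f set \<Rightarrow> ('k, 'a::ab_group_add) graded_lie_alg \<Rightarrow>
   ('f \<Rightarrow> 'a) \<Rightarrow> bool" where
  "is_graded_quotient g K m \<pi> \<longleftrightarrow>
     lie_hom g m \<pi> \<and> \<pi> ` carrier g = carrier m \<and> {x \<in> carrier g. \<pi> x = 0} = K \<and>
     (\<forall>p. \<pi> ` component g p = component m p)"


section \<open>The free Lie algebra\<close>

text \<open>
  \<open>free_lie_algebra sV F \<iota>\<close>: \<open>F\<close> is the free Lie algebra on the vector space \<open>V\<close> of all elements of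
  \<^typ>\<open>'v\<close>, and \<open>\<iota>\<close> is the inclusion of \<open>V\<close>. Since \<open>F\<close> is required to be generated by \<open>V\<close>, the
  extension \<open>\<phi>\<close> in the universal property is unique on \<open>F\<close>.

  A definition cannot quantify over types, so the universal property is tested on the Lie algebras
  carried by subspaces of the type \<^typ>\<open>'k poly\<close>, a vector space of countably infinite dimension. Every
  Lie algebra of countable dimension is isomorphic to one of these. As only finite dimensional \<open>V\<close>
  will be considered, any Lie algebra generated by a linear image of \<open>V\<close> has countable dimension, and
  the universal property for all Lie algebras follows.
\<close>

definition free_lie_algebra ::
  "('k::field \<Rightarrow> 'v::ab_group_add \<Rightarrow> 'v) \<Rightarrow> ('k, 'f::ab_group_add, 'm) lie_alg_scheme \<Rightarrow>
   ('v \<Rightarrow> 'f) \<Rightarrow> bool" where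
  "free_lie_algebra sV F \<iota> \<longleftrightarrow>
     lie_algebra F \<and> Vector_Spaces.linear sV (smul F) \<iota> \<and> range \<iota> \<subseteq> carrier F \<and>
     (\<forall>S. module.subspace (smul F) S \<and> range \<iota> \<subseteq> S \<and> S \<subseteq> carrier F \<and>
          (\<forall>x\<in>S. \<forall>y\<in>S. bracket F x y \<in> S) \<longrightarrow> S = carrier F) \<and>
     (\<forall>(h :: ('k, 'k poly) lie_alg) f.
          lie_algebra h \<and> Vector_Spaces.linear sV (smul h) f \<and> range f \<subseteq> carrier h \<longrightarrow>
          (\<exists>\<phi>. lie_hom F h \<phi> \<and> (\<forall>v. \<phi> (\<iota> v) = f v)))"

text \<open>The free Lie algebra with its grading; it is concentrated in negative degrees, with \<open>V\<close> in
  degree \<open>-1\<close>.\<close>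

definition graded_free_lie_algebra ::
  "('k::field \<Rightarrow> 'v::ab_group_add \<Rightarrow> 'v) \<Rightarrow> ('k, 'f::ab_group_add) graded_lie_alg \<Rightarrow>
   ('v \<Rightarrow> 'f) \<Rightarrow> bool" where
  "graded_free_lie_algebra sV F \<iota> \<longleftrightarrow>
     free_lie_algebra sV F \<iota> \<and> graded_lie_algebra F \<and>
     (\<forall>p\<ge>0. component F p = {0}) \<and> bij_betw \<iota> UNIV (component F (-1))"

definition filtration :: "('k::field, 'f::ab_group_add) graded_lie_alg \<Rightarrow> int \<Rightarrow> 'f set" where
  "filtration F q = component_sum F {..- q}"

definition cofinite_ideal :: "('k::field, 'f::ab_group_add) graded_lie_alg \<Rightarrow> 'f set \<Rightarrow> bool" where
  "cofinite_ideal F K \<longleftrightarrow> lie_ideal F K \<and> (\<exists>\<mu>\<ge>1. filtration F (\<mu> + 1) \<subseteq> K)"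


section \<open>Effective prolongations\<close>

text \<open>
  \<open>effective_prolongation F K g \<pi>\<close>: \<open>g\<close> is an effective prolongation of \<open>F/K\<close>, where \<open>F/K\<close> is
  identified with the negative part of \<open>g\<close> by means of the projection \<open>\<pi>\<close>.
\<close>

definition effective_prolongation ::
  "('k::field, 'f::ab_group_add) graded_lie_alg \<Rightarrow> 'f set \<Rightarrow> ('k, 'a::ab_group_add) graded_lie_alg \<Rightarrow>
   ('f \<Rightarrow> 'a) \<Rightarrow> bool" where
  "effective_prolongation F K g \<pi> \<longleftrightarrow>
     graded_lie_algebra g \<and>
     is_graded_quotient F K (negative_part g) \<pi> \<and>
     {X \<in> component_sum g {0..}. \<forall>Y\<in>component g (-1). bracket g X Y = 0} = {0}"

definition of_type ::
  "('v \<Rightarrow> 'f) \<Rightarrow> ('v \<Rightarrow> 'v) set \<Rightarrow> ('k::field, 'a::ab_group_add) graded_lie_alg \<Rightarrow> ('f \<Rightarrow> 'a) \<Rightarrow> bool" where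
  "of_type \<iota> L g \<pi> \<longleftrightarrow>
     (\<forall>A\<in>component g 0. \<exists>a\<in>L. \<forall>v. bracket g A (\<pi> (\<iota> v)) = \<pi> (\<iota> (a v)))"

text \<open>
  \<open>maximal_prolongation F \<iota> K L g \<pi>\<close>: \<open>g\<close> is the maximal effective prolongation of type \<open>L\<close> of
  \<open>F/K\<close>. The equation \<open>\<phi> (\<rho> x) = \<pi> x\<close> says that the embedding \<open>\<phi>\<close> is the identity on \<open>F/K\<close>.

  Again the competing prolongations \<open>h\<close> range over those carried by subspaces of \<^typ>\<open>'k poly\<close>.
  This loses nothing when \<open>V\<close> is finite dimensional and \<open>K\<close> is cofinite: then \<open>F/K\<close> has finite
  dimension, and for \<open>p \<ge> 0\<close> effectiveness embeds the degree \<open>p\<close> component of a prolongation into the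
  space of linear maps from the component of degree \<open>-1\<close> to that of degree \<open>p - 1\<close>. Thus all the
  components have finite dimension, and every effective prolongation has countable dimension.
\<close>

definition maximal_prolongation ::
  "('k::field, 'f::ab_group_add) graded_lie_alg \<Rightarrow> ('v \<Rightarrow> 'f) \<Rightarrow> 'f set \<Rightarrow> ('v \<Rightarrow> 'v) set \<Rightarrow>
   ('k, 'a::ab_group_add) graded_lie_alg \<Rightarrow> ('f \<Rightarrow> 'a) \<Rightarrow> bool" where
  "maximal_prolongation F \<iota> K L g \<pi> \<longleftrightarrow>
     effective_prolongation F K g \<pi> \<and> of_type \<iota> L g \<pi> \<and>
     (\<forall>(h :: ('k, 'k poly) graded_lie_alg) \<rho>.
        effective_prolongation F K h \<rho> \<and> of_type \<iota> L h \<rho> \<longrightarrow>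
        (\<exists>\<phi>. lie_hom h g \<phi> \<and> inj_on \<phi> (carrier h) \<and>
             (\<forall>p. \<phi> ` component h p \<subseteq> component g p) \<and>
             (\<forall>x\<in>carrier F. \<phi> (\<rho> x) = \<pi> x)))"

end

theory Submission
  imports Defs "HOL-Library.Function_Algebras" "HOL-Library.Countable_Set"
begin

text \<open>
  Let \<open>C k\<close> be the part of \<open>\<gg> = \<gg>(K, L)\<close> that commutes with all components of degree at most
  \<open>-k\<close>. The negative part of \<open>\<gg>\<close> together with the nonnegative part of \<open>C 2\<close> is a subalgebra in
  which the image of \<open>K'\<close> is an ideal, and the quotient is an effective prolongation of \<open>F/K'\<close> of
  type \<open>L'\<close>. It embeds in \<open>\<gg>(K', L')\<close>; so if the latter has finite dimension, \<open>C 2\<close> vanishes in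
  large degrees.

  This vanishing propagates from \<open>C k\<close> to \<open>C (k + 1)\<close>, and \<open>C k = \<gg>\<close> for large \<open>k\<close> because \<open>K\<close> is
  cofinite. The propagation rests on the following fact in characteristic zero. Let
  \<open>N = \<Sum>\<^sub>p N\<^sub>p\<close> be a graded module with components of finite dimension over a Heisenberg algebra
  \<open>[a, b] = z\<close>, with \<open>a\<close>, \<open>b\<close>, \<open>z\<close> of degrees \<open>-1\<close>, \<open>-k + 1\<close>, \<open>-k\<close>. If \<open>z\<close> is injective in large
  degrees, then \<open>N\<close> vanishes in large degrees. Indeed, the dimensions of the \<open>N\<^sub>p\<close> are then bounded,
  so some nonzero \<open>\<Sum>\<^sub>i c\<^sub>i z\<^bsup>D - i\<^esup> a\<^bsup>k i\<^esup>\<close> annihilates all of them for large \<open>p\<close>, and repeated commutation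
  with \<open>b\<close> turns this relation into \<open>z\<^bsup>m\<^esup> = 0\<close>.
\<close>

section \<open>Finite spanning sets and linear relations\<close>

section \<open>Linear algebra\<close>

lemma vector_space_fun:
  assumes "vector_space s"
  shows "vector_space (\<lambda>c f x. s c (f x))"
proof -
  interpret vector_space s by fact
  show ?thesis
    by unfold_locales (auto simp: fun_eq_iff scale_right_distrib scale_left_distrib)
qed

text \<open>A basis of \<open>W\<close> has an independent image inside \<open>span B\<close>, so
  its size is at most \<open>card B\<close>. The explicit bound is what later keeps the dimensions
  in a graded module uniformly bounded.\<close>

lemma (in vector_space_pair) finite_span_pullback:
  assumes f: "Vector_Spaces.linear s1 s2 f" and W: "vs1.subspace W" and inj: "inj_on f W"
    and B: "finite B" "f ` W \<subseteq> vs2.span B"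
  obtains A where "finite A" "card A \<le> card B" "A \<subseteq> W" "vs1.span A = W"
proof -
  interpret f: Vector_Spaces.linear s1 s2 f by fact
  obtain A where A: "A \<subseteq> W" "vs1.independent A" "W \<subseteq> vs1.span A"
    using vs1.maximal_independent_subset by blast
  have sp: "vs1.span A = W"
    using A W vs1.span_minimal by blast
  have "vs2.independent (f ` A)"
    using f.independent_injective_image A(2) inj sp by blast
  moreover have "f ` A \<subseteq> vs2.span B" using A B by blast
  ultimately have *: "finite (f ` A)" "card (f ` A) \<le> card B"
    using vs2.independent_span_bound B by blast+
  have "inj_on f A" using inj A inj_on_subset by blast
  then show thesis using that * sp A
    by (metis card_image finite_image_iff)
qed

text \<open>The generators are matrix units: functions supported at one point of \<open>E\<close>
  with a value in \<open>U\<close>. Extension by zero off \<open>E\<close> turns a finite family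
  into a vector.\<close>

lemma (in vector_space) restricted_fun_in_span:
  fixes h :: "'c \<Rightarrow> 'b"
  assumes E: "finite E" and h: "\<And>e. e \<in> E \<Longrightarrow> h e \<in> span U"
  shows "(\<lambda>e. if e \<in> E then h e else 0)
    \<in> module.span (\<lambda>c f x. scale c (f x)) ((\<lambda>(e, u) e'. if e' = e then u else 0) ` (E \<times> U))"
proof -
  let ?s = "\<lambda>c (h::'c \<Rightarrow> 'b) x. scale c (h x)"
  interpret fs: vector_space ?s by (rule vector_space_fun) unfold_locales
  let ?B = "(\<lambda>(e,u) e'. if e' = e then u else 0) ` (E \<times> U)"
  have 1: "(\<lambda>e'. if e' = e then y else 0) \<in> fs.span ?B" if e: "e \<in> E" and y: "y \<in> span U" for e y
    using y
  proof (induction rule: span_induct_alt)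
    case base
    then show ?case using fs.span_zero by (simp add: zero_fun_def)
  next
    case (step c u y)
    have "(\<lambda>e'. if e' = e then u else 0) \<in> ?B" using e step(1) by force
    then have "?s c (\<lambda>e'. if e' = e then u else 0) + (\<lambda>e'. if e' = e then y else 0) \<in> fs.span ?B"
      by (intro fs.span_add fs.span_scale step(2)) (rule fs.span_base)
    moreover have "?s c (\<lambda>e'. if e' = e then u else 0) + (\<lambda>e'. if e' = e then y else 0)
        = (\<lambda>e'. if e' = e then scale c u + y else 0)" by (auto simp: fun_eq_iff)
    ultimately show ?case by simp
  qed
  have "(\<lambda>e. if e \<in> E then h e else 0) = (\<Sum>e\<in>E. (\<lambda>e'. if e' = e then h e else 0))"
  proof
    fix e'
    have "(\<Sum>e\<in>E. (\<lambda>e'. if e' = e then h e else 0)) e' = (\<Sum>e\<in>E. if e' = e then h e else 0)"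
      using E by (induction E rule: finite_induct) auto
    then show "(if e' \<in> E then h e' else 0) = (\<Sum>e\<in>E. (\<lambda>e'. if e' = e then h e else 0)) e'"
      using E by (simp add: sum.delta')
  qed
  also have "\<dots> \<in> fs.span ?B"
    by (intro fs.span_sum 1) (use h in auto)
  finally show ?thesis .
qed

text \<open>Bundling the maps \<open>f e\<close> into one function of \<open>e\<close> gives an
  injective linear map from \<open>W\<close> into a finitely spanned space of functions. This will
  bound components of nonnegative degree through their brackets with degree
  \<open>-1\<close>.\<close>

lemma (in vector_space) finite_span_jointly_injective:
  assumes W: "subspace W" and E: "finite E"
    and lin: "\<And>e. e \<in> E \<Longrightarrow> Vector_Spaces.linear scale scale (f e)"
    and U: "finite U" "\<And>e x. e \<in> E \<Longrightarrow> x \<in> W \<Longrightarrow> f e x \<in> span U"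
    and inj: "\<And>x. x \<in> W \<Longrightarrow> (\<And>e. e \<in> E \<Longrightarrow> f e x = 0) \<Longrightarrow> x = 0"
  obtains A where "finite A" "A \<subseteq> W" "span A = W"
proof -
  let ?s = "\<lambda>c (h::'c \<Rightarrow> 'b) x. scale c (h x)"
  interpret fs: vector_space ?s by (rule vector_space_fun) unfold_locales
  interpret vp: vector_space_pair scale ?s ..
  define F where "F x = (\<lambda>e. if e \<in> E then f e x else 0)" for x
  define B where "B = (\<lambda>(e,u) e'. if e' = e then u else 0) ` (E \<times> U)"
  have F: "Vector_Spaces.linear scale ?s F"
  proof -
    have "f e (x + y) = f e x + f e y" "f e (scale c x) = scale c (f e x)" if "e \<in> E" for e x y c
      using lin[OF that] by (auto simp: Vector_Spaces.linear_iff)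
    then show ?thesis unfolding Vector_Spaces.linear_iff F_def
      by (auto simp: fun_eq_iff intro!: vector_space_axioms fs.vector_space_axioms)
  qed
  interpret F: Vector_Spaces.linear scale ?s F by (rule F)
  have "F x \<in> fs.span B" if x: "x \<in> W" for x
    unfolding F_def B_def by (rule restricted_fun_in_span[OF E]) (rule U(2)[OF _ x])
  then have sub: "F ` W \<subseteq> fs.span B" by (rule image_subsetI)
  have "x = 0" if "x \<in> W" "F x = 0" for x
  proof (rule inj[OF that(1)])
    fix e assume "e \<in> E"
    then show "f e x = 0" using fun_cong[OF that(2), of e] by (simp add: F_def)
  qed
  then have "inj_on F W"
    unfolding F.inj_on_iff_eq_0[OF W] by blast
  moreover have "finite B" using E U unfolding B_def by auto
  ultimately obtain A where "finite A" "A \<subseteq> W" "span A = W"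
    using vp.finite_span_pullback[OF F W _ _ sub] by metis
  then show thesis by (rule that)
qed

text \<open>Restricted to \<open>X\<close>, the \<open>D + 1\<close> maps \<open>T i\<close> become
  vectors in a space spanned by at most \<open>card X * card B\<close> elements, hence are
  dependent.\<close>

lemma (in vector_space) exists_common_relation:
  fixes T :: "nat \<Rightarrow> 'b \<Rightarrow> 'b"
  assumes X: "finite X" and B: "finite B" and D: "card X * card B \<le> D"
    and T: "\<And>i x. i \<le> D \<Longrightarrow> x \<in> X \<Longrightarrow> T i x \<in> span B"
  obtains c where "\<exists>i\<le>D. c i \<noteq> 0" "\<And>x. x \<in> X \<Longrightarrow> (\<Sum>i\<le>D. scale (c i) (T i x)) = 0"
proof -
  let ?s = "\<lambda>c (h::'b \<Rightarrow> 'b) x. scale c (h x)"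
  interpret fs: vector_space ?s by (rule vector_space_fun) unfold_locales
  define F where "F i = (\<lambda>x. if x \<in> X then T i x else 0)" for i
  let ?B = "(\<lambda>(e,u) e'. if e' = e then u else 0) ` (X \<times> B)"
  have sp: "F i \<in> fs.span ?B" if i: "i \<le> D" for i
    unfolding F_def by (rule restricted_fun_in_span[OF X]) (rule T[OF i])
  then have spF: "F ` {..D} \<subseteq> fs.span ?B" by auto
  have finB: "finite ?B" using X B by auto
  show thesis
  \<comment> \<open>Dependence is a property of sets and does not see repetitions among the
    \<open>F i\<close>; a repetition supplies its own relation, the difference of two equal
    members.\<close>
  proof (cases "inj_on F {..D}")
    case True
    have "card ?B \<le> D"
      by (rule order.trans[OF card_image_le]) (use X B D in \<open>auto simp: card_cartesian_product\<close>)
    then have "\<not> card (F ` {..D}) \<le> card ?B" by (simp add: card_image[OF True])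
    then have "fs.dependent (F ` {..D})"
      using fs.independent_span_bound[of ?B "F ` {..D}"] finB spF by metis
    then have "\<exists>u. (\<exists>v\<in>F ` {..D}. u v \<noteq> 0) \<and> (\<Sum>v\<in>F ` {..D}. ?s (u v) v) = 0"
      by (rule iffD1[OF fs.dependent_finite[OF finite_imageI[OF finite_atMost]]])
    then obtain u where u: "\<exists>v\<in>F ` {..D}. u v \<noteq> 0" "(\<Sum>v\<in>F ` {..D}. ?s (u v) v) = 0"
      by (elim exE conjE)
    have eval: "(\<Sum>i\<in>I. ?s (u (F i)) (F i)) x = (\<Sum>i\<in>I. scale (u (F i)) (T i x))"
      if "finite I" "x \<in> X" for x I
      using that by (induction I rule: finite_induct) (auto simp: F_def)
    have "(\<Sum>i\<le>D. ?s (u (F i)) (F i)) = 0"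
      using u(2) sum.reindex[OF True, of "\<lambda>v. ?s (u v) v"] by (simp add: o_def)
    then have "(\<Sum>i\<le>D. scale (u (F i)) (T i x)) = 0" if "x \<in> X" for x
      using eval[of "{..D}" x] that by (metis finite_atMost zero_fun_apply)
    moreover have "\<exists>i\<le>D. u (F i) \<noteq> 0" using u(1) by auto
    ultimately show ?thesis by (rule that[rotated])
  next
    case False
    then obtain i j where ij: "i \<le> D" "j \<le> D" "i \<noteq> j" "F i = F j"
      unfolding inj_on_def by auto
    define c where "c t = (if t = i then 1 else if t = j then - 1 else (0::'a))" for t
    have "(\<Sum>t\<le>D. scale (c t) (T t x)) = 0" if "x \<in> X" for x
    proof -
      have "(\<Sum>t\<le>D. scale (c t) (T t x)) = (\<Sum>t\<in>{i,j}. scale (c t) (T t x))"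
        by (rule sum.mono_neutral_right) (use ij in \<open>auto simp: c_def\<close>)
      also have "\<dots> = T i x - T j x" using ij(3) by (simp add: c_def)
      also have "\<dots> = 0" using fun_cong[OF ij(4), of x] that by (simp add: F_def)
      finally show ?thesis .
    qed
    moreover have "\<exists>i\<le>D. c i \<noteq> 0" using ij(1) by (auto simp: c_def)
    ultimately show ?thesis by (rule that[rotated])
  qed
qed

section \<open>Vanishing in large degrees by differentiating a polynomial relation\<close>

section \<open>Graded modules over a Heisenberg algebra\<close>

text \<open>The operators are linear on the whole type, but the commutation relations are demanded
  on the components only: the total brackets to be substituted satisfy the Jacobi identity only on
  the span of the components.\<close>

locale heisenberg_module =
  vector_space s for s :: "'k::field_char_0 \<Rightarrow> 'a::ab_group_add \<Rightarrow> 'a" +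
  fixes a b z :: "'a \<Rightarrow> 'a" and N :: "int \<Rightarrow> 'a set" and k :: nat and P :: int
  assumes lin_a: "Vector_Spaces.linear s s a"
    and lin_b: "Vector_Spaces.linear s s b"
    and lin_z: "Vector_Spaces.linear s s z"
    and N_subspace: "subspace (N p)"
    and N_finite: "\<exists>A. finite A \<and> span A = N p"
    and k_pos: "k > 0"
    and a_N: "x \<in> N p \<Longrightarrow> a x \<in> N (p - 1)"
    and b_N: "x \<in> N p \<Longrightarrow> b x \<in> N (p - int k + 1)"
    and z_N: "x \<in> N p \<Longrightarrow> z x \<in> N (p - int k)"
    and ab: "x \<in> N p \<Longrightarrow> a (b x) = b (a x) + z x"
    and az: "x \<in> N p \<Longrightarrow> a (z x) = z (a x)"
    and bz: "x \<in> N p \<Longrightarrow> b (z x) = z (b x)"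
    and z_inj: "p \<ge> P \<Longrightarrow> x \<in> N p \<Longrightarrow> z x = 0 \<Longrightarrow> x = 0"
begin

sublocale a: Vector_Spaces.linear s s a by (rule lin_a)
sublocale b: Vector_Spaces.linear s s b by (rule lin_b)
sublocale z: Vector_Spaces.linear s s z by (rule lin_z)

lemma apow_N: "x \<in> N p \<Longrightarrow> (a ^^ i) x \<in> N (p - int i)"
proof (induction i)
  case (Suc i)
  then show ?case using a_N[of "(a ^^ i) x" "p - int i"] by (simp add: algebra_simps)
qed simp

lemma zpow_N: "x \<in> N p \<Longrightarrow> (z ^^ i) x \<in> N (p - int k * int i)"
proof (induction i)
  case (Suc i)
  then show ?case using z_N[of "(z ^^ i) x" "p - int k * int i"] by (simp add: algebra_simps)
qed simp

lemma zpow_inj: "p \<ge> P + int k * int j \<Longrightarrow> x \<in> N p \<Longrightarrow> (z ^^ j) x = 0 \<Longrightarrow> x = 0"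
proof (induction j)
  case (Suc j)
  then have "(z ^^ j) x = 0"
    using z_inj[of "p - int k * int j" "(z ^^ j) x"] zpow_N[of x p j] k_pos
    by (simp add: algebra_simps)
  moreover have "P + int k * int j \<le> p" using Suc.prems(1) by (simp add: algebra_simps)
  ultimately show ?case using Suc by blast
qed simp

lemma zpow_linear:
  "(z ^^ i) (x + y) = (z ^^ i) x + (z ^^ i) y" "(z ^^ i) (s c x) = s c ((z ^^ i) x)"
  by (induction i) (auto simp: z.add z.scale)

lemma apow_linear:
  "(a ^^ i) (x + y) = (a ^^ i) x + (a ^^ i) y" "(a ^^ i) (s c x) = s c ((a ^^ i) x)"
  by (induction i) (auto simp: a.add a.scale)

lemma apow_z: "x \<in> N p \<Longrightarrow> (a ^^ i) (z x) = z ((a ^^ i) x)"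
proof (induction i)
  case (Suc i)
  then show ?case using az[OF apow_N[OF Suc.prems, of i]] by simp
qed simp

lemma b_zpow: "x \<in> N p \<Longrightarrow> b ((z ^^ i) x) = (z ^^ i) (b x)"
proof (induction i)
  case (Suc i)
  then show ?case using bz[OF zpow_N[OF Suc.prems, of i]] by simp
qed simp

text \<open>Moving \<open>b\<close> past one factor \<open>a\<close> costs one central
  \<open>z\<close>. For \<open>i = 0\<close> the truncated exponent \<open>i - 1\<close> is
  harmless, since its coefficient vanishes.\<close>

lemma apow_b:
  "x \<in> N p \<Longrightarrow> (a ^^ i) (b x) = b ((a ^^ i) x) + s (of_nat i) (z ((a ^^ (i - 1)) x))"
proof (induction i)
  case (Suc i)
  have "(a ^^ Suc i) (b x) = a (b ((a ^^ i) x)) + s (of_nat i) (a (z ((a ^^ (i - 1)) x)))"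
    using Suc by (simp add: a.add a.scale)
  also have "a (b ((a ^^ i) x)) = b ((a ^^ Suc i) x) + z ((a ^^ i) x)"
    using ab[OF apow_N[OF Suc.prems]] by simp
  also have "s (of_nat i) (a (z ((a ^^ (i - 1)) x))) = s (of_nat i) (z ((a ^^ i) x))"
    using az[OF apow_N[OF Suc.prems, of "i - 1"]] by (cases i) auto
  finally show ?case by (simp add: scale_left_distrib algebra_simps)
qed simp

text \<open>Above degree \<open>P\<close> the operator \<open>z\<close> embeds each component in the one \<open>k\<close> degrees below, so that
  the dimension is bounded by its maximum over a window of length \<open>k\<close>.\<close>

lemma dimension_bounded:
  obtains d where "\<And>p. p \<ge> P - int k \<Longrightarrow> \<exists>A. finite A \<and> card A \<le> d \<and> A \<subseteq> N p \<and> span A = N p"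
proof -
  interpret vp: vector_space_pair s s ..
  obtain S where S: "\<And>p. finite (S p) \<and> span (S p) = N p"
    using N_finite by metis
  \<comment> \<open>The sum over the window is a crude substitute for the maximum.\<close>
  define d where "d = (\<Sum>p\<in>{P - int k..<P}. card (S p))"
  have "\<exists>A. finite A \<and> card A \<le> d \<and> A \<subseteq> N (P - int k + int m) \<and> span A = N (P - int k + int m)" for m
  proof (induction m rule: less_induct)
    case (less m)
    define p where "p = P - int k + int m"
    show ?case
    proof (cases "m < k")
      case True
      then have "card (S p) \<le> d"
        unfolding d_def p_def by (intro member_le_sum) auto
      moreover have "S p \<subseteq> N p" using S[of p] span_superset by metis
      ultimately show ?thesis using S[of p] unfolding p_def by blast
    next
      case False
      then have eq: "P - int k + int (m - k) = p - int k" by (simp add: p_def)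
      obtain A where A: "finite A" "card A \<le> d" "span A = N (p - int k)"
        using less.IH[of "m - k"] False k_pos unfolding eq by (metis diff_less not_less zero_less_iff_neq_zero le_zero_eq)
      have "inj_on z (N p)"
        using z.inj_on_iff_eq_0[OF N_subspace] z_inj[of p] False by (auto simp: p_def)
      moreover have "z ` N p \<subseteq> span A" using z_N A by auto
      ultimately obtain A' where "finite A'" "card A' \<le> card A" "A' \<subseteq> N p" "span A' = N p"
        using vp.finite_span_pullback[OF lin_z N_subspace _ A(1)] by metis
      then show ?thesis using A(2) unfolding p_def by (metis order.trans)
    qed
  qed
  then have "\<exists>A. finite A \<and> card A \<le> d \<and> A \<subseteq> N p \<and> span A = N p" if "p \<ge> P - int k" for p
    using that by (metis add_diff_cancel_left' le_iff_diff_le_0 diff_add_cancel add.commute nonneg_int_cases diff_ge_0_iff_ge)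
  then show thesis by (rule that)
qed

text \<open>All the monomials lower the degree by \<open>k * D\<close>, and they outnumber the
  product of the dimensions of two windows of \<open>k\<close> components. A relation found on one
  window propagates upwards because it commutes with the injective \<open>z\<close>.\<close>

lemma exists_polynomial_relation:
  obtains D c p\<^sub>0 where "\<exists>i\<le>D. c i \<noteq> 0"
    "\<And>p x. p \<ge> p\<^sub>0 \<Longrightarrow> x \<in> N p \<Longrightarrow> (\<Sum>i\<le>D. s (c i) ((z ^^ (D - i)) ((a ^^ (k * i)) x))) = 0"
proof -
  obtain d where d: "\<And>p. p \<ge> P - int k \<Longrightarrow> \<exists>A. finite A \<and> card A \<le> d \<and> A \<subseteq> N p \<and> span A = N p"
    using dimension_bounded by blast
  obtain S where S: "\<And>p. p \<ge> P - int k \<Longrightarrow> finite (S p) \<and> card (S p) \<le> d \<and> S p \<subseteq> N p \<and> span (S p) = N p"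
    using d by metis
  define D where "D = (k * d) * (k * d)"
  \<comment> \<open>The monomials carry degree \<open>p\<^sub>0 + l\<close> to \<open>P + l\<close>,
    so their values stay where \<open>z\<close> is injective.\<close>
  define p\<^sub>0 where "p\<^sub>0 = P + int k * int D"
  define X where "X = (\<Union>l<k. S (p\<^sub>0 + int l))"
  define Y where "Y = (\<Union>l<k. S (P + int l))"
  define T where "T i x = (z ^^ (D - i)) ((a ^^ (k * i)) x)" for i x
  have ge: "p\<^sub>0 + int l \<ge> P - int k" "P + int l \<ge> P - int k" for l
    by (auto simp: p\<^sub>0_def intro: add_increasing)
  have fin: "finite X" "finite Y" using S ge by (auto simp: X_def Y_def)
  have "card X \<le> (\<Sum>l<k. card (S (p\<^sub>0 + int l)))"
    unfolding X_def by (rule card_UN_le) simp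
  also have "\<dots> \<le> k * d"
    using sum_bounded_above[of "{..<k}" "\<lambda>l. card (S (p\<^sub>0 + int l))" d] S ge by simp
  finally have cX: "card X \<le> k * d" .
  have "card Y \<le> (\<Sum>l<k. card (S (P + int l)))"
    unfolding Y_def by (rule card_UN_le) simp
  also have "\<dots> \<le> k * d"
    using sum_bounded_above[of "{..<k}" "\<lambda>l. card (S (P + int l))" d] S ge by simp
  finally have cY: "card Y \<le> k * d" .
  have T_N: "T i x \<in> N (p - int k * int D)" if "i \<le> D" "x \<in> N p" for i x p
  proof -
    have "T i x \<in> N (p - int (k * i) - int k * int (D - i))"
      unfolding T_def by (intro zpow_N apow_N that)
    moreover have "p - int (k * i) - int k * int (D - i) = p - int k * int D"
      using that(1) by (simp add: of_nat_diff algebra_simps)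
    ultimately show ?thesis by metis
  qed
  have T_linear: "T i (x + y) = T i x + T i y" "T i (s c x) = s c (T i x)" for i x y c
    unfolding T_def by (simp_all add: apow_linear zpow_linear)
  have T_z: "T i (z x) = z (T i x)" if "x \<in> N p" for i x p
    unfolding T_def by (simp add: apow_z[OF that] funpow_swap1)
  have "T i x \<in> span Y" if i: "i \<le> D" and x: "x \<in> X" for i x
  proof -
    obtain l where l: "l < k" "x \<in> S (p\<^sub>0 + int l)" using x unfolding X_def by blast
    then have "x \<in> N (p\<^sub>0 + int l)" using S ge by blast
    then have "T i x \<in> N (P + int l)" using T_N[OF i] by (fastforce simp: p\<^sub>0_def)
    then have "T i x \<in> span (S (P + int l))" using S ge by blast
    moreover have "S (P + int l) \<subseteq> Y" unfolding Y_def using l by blast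
    ultimately show ?thesis using span_mono by blast
  qed
  moreover have "card X * card Y \<le> D" unfolding D_def by (rule mult_le_mono[OF cX cY])
  ultimately obtain c where c: "\<exists>i\<le>D. c i \<noteq> 0"
    and rel: "\<And>x. x \<in> X \<Longrightarrow> (\<Sum>i\<le>D. s (c i) (T i x)) = 0"
    using exists_common_relation[OF fin, of D T] by metis
  define R where "R x = (\<Sum>i\<le>D. s (c i) (T i x))" for x
  have R_add: "R (x + y) = R x + R y" for x y
    unfolding R_def T_linear scale_right_distrib sum.distrib ..
  have R_scale: "R (s c x) = s c (R x)" for c x
    unfolding R_def T_linear scale_sum_right by (simp add: mult.commute)
  have R_N: "R x \<in> N (p - int k * int D)" if "x \<in> N p" for x p
    unfolding R_def by (intro subspace_sum N_subspace subspace_scale T_N that) auto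
  have R_z: "R (z x) = z (R x)" if "x \<in> N p" for x p
    unfolding R_def by (simp add: z.sum z.scale T_z[OF that])
  have base: "R x = 0" if "l < k" "x \<in> N (p\<^sub>0 + int l)" for l x
  proof -
    have "x \<in> span (S (p\<^sub>0 + int l))" using that S ge by blast
    then show ?thesis
    proof (induction rule: span_induct_alt)
      case base
      show ?case using R_scale[of 0 0] by simp
    next
      case (step c x y)
      then have "R x = 0" using rel that(1) unfolding R_def X_def by blast
      then show ?case using step by (simp add: R_add R_scale)
    qed
  qed
  have "R x = 0" if "x \<in> N (p\<^sub>0 + int m)" for m x
    using that
  proof (induction m arbitrary: x rule: less_induct)
    case (less m)
    show ?case
    proof (cases "m < k")
      case True
      then show ?thesis using base less.prems by blast
    next
      case False
      \<comment> \<open>The relation holds at \<open>z x\<close>, which lies \<open>k\<close>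
        degrees lower; as \<open>R x\<close> has degree at least \<open>P\<close>,
        \<open>z (R x) = 0\<close> forces \<open>R x = 0\<close>.\<close>
      then have "z x \<in> N (p\<^sub>0 + int (m - k))"
        using z_N[OF less.prems] by (simp add: of_nat_diff algebra_simps)
      then have "z (R x) = 0" using less.IH[of "m - k"] False k_pos R_z[OF less.prems] by simp
      moreover have "p\<^sub>0 + int m - int k * int D \<ge> P" by (simp add: p\<^sub>0_def)
      ultimately show ?thesis using z_inj R_N[OF less.prems] by blast
    qed
  qed
  then have "R x = 0" if "p \<ge> p\<^sub>0" "x \<in> N p" for p x
    using that by (metis add_diff_cancel_left' diff_add_cancel add.commute nonneg_int_cases diff_ge_0_iff_ge)
  then show thesis using that[OF c] unfolding R_def T_def by blast
qed

text \<open>Commuting \<open>k e\<close> times with \<open>b\<close> differentiates a relation of degree \<open>k e\<close> in \<open>a\<close> down to its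
  leading term, a nonzero multiple of a power of the injective operator \<open>z\<close>.\<close>

theorem eventually_zero: "\<exists>Q. \<forall>p\<ge>Q. N p = {0}"
proof -
  obtain D c p\<^sub>0 where c: "\<exists>i\<le>D. c i \<noteq> 0"
    and rel: "\<And>p x. p \<ge> p\<^sub>0 \<Longrightarrow> x \<in> N p \<Longrightarrow> (\<Sum>i\<le>D. s (c i) ((z ^^ (D - i)) ((a ^^ (k * i)) x))) = 0"
    using exists_polynomial_relation by metis
  \<comment> \<open>The falling factorial, the coefficient in the \<open>m\<close>-th derivative of
    a monomial of exponent \<open>v\<close>. Truncated subtraction makes it zero as soon as
    \<open>m > v\<close>.\<close>
  define ff :: "nat \<Rightarrow> nat \<Rightarrow> nat" where "ff v m = (\<Prod>t<m. v - t)" for v m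
  \<comment> \<open>Up to that coefficient, the \<open>m\<close>-th derivative in \<open>a\<close>
    of the \<open>i\<close>-th monomial, each differentiation contributing a factor
    \<open>z\<close>. When \<open>m > k * i\<close> the truncated exponent is meaningless, but the
    coefficient is zero.\<close>
  define W where "W m i x = (z ^^ (D - i + m)) ((a ^^ (k * i - m)) x)" for m i x
  have W_b: "W m i (b x) = b (W m i x) + s (of_nat (k * i - m)) (W (Suc m) i x)" if "x \<in> N p" for m i x p
  proof -
    have "W m i (b x) = (z ^^ (D - i + m)) (b ((a ^^ (k * i - m)) x))
        + s (of_nat (k * i - m)) ((z ^^ (D - i + m)) (z ((a ^^ (k * i - m - 1)) x)))"
      unfolding W_def apow_b[OF that] by (simp add: zpow_linear)
    also have "(z ^^ (D - i + m)) (b ((a ^^ (k * i - m)) x)) = b (W m i x)"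
      unfolding W_def b_zpow[OF apow_N[OF that]] ..
    also have "(z ^^ (D - i + m)) (z ((a ^^ (k * i - m - 1)) x)) = W (Suc m) i x"
      unfolding W_def by (simp add: funpow_swap1)
    finally show ?thesis .
  qed
  have derived: "(\<Sum>i\<le>D. s (c i * of_nat (ff (k * i) m)) (W m i x)) = 0"
    if "p \<ge> p\<^sub>0 + int k * int m" "x \<in> N p" for m p x
    using that
  proof (induction m arbitrary: p x)
    case 0
    then show ?case using rel[of p x] by (simp add: W_def ff_def)
  next
    case (Suc m)
    let ?f = "\<lambda>i. c i * of_nat (ff (k * i) m)"
    have 1: "(\<Sum>i\<le>D. s (?f i) (W m i x)) = 0"
      using Suc.IH[of p x] Suc.prems by (simp add: algebra_simps)
    \<comment> \<open>The element \<open>b x\<close> has degree \<open>p - k + 1\<close>; the margin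
      of \<open>k\<close> degrees per differentiation keeps it within the induction
      hypothesis.\<close>
    have 2: "(\<Sum>i\<le>D. s (?f i) (W m i (b x))) = 0"
      by (rule Suc.IH[OF _ b_N[OF Suc.prems(2)]]) (use Suc.prems(1) in \<open>simp add: algebra_simps\<close>)
    have "(\<Sum>i\<le>D. s (?f i) (W m i (b x)))
        = b (\<Sum>i\<le>D. s (?f i) (W m i x)) + (\<Sum>i\<le>D. s (c i * of_nat (ff (k * i) (Suc m))) (W (Suc m) i x))"
      unfolding W_b[OF Suc.prems(2)] b.sum b.scale sum.distrib[symmetric]
      by (intro sum.cong refl) (simp add: scale_right_distrib ff_def mult.assoc)
    then show ?case using 1 2 by simp
  qed
  define e where "e = (GREATEST i. i \<le> D \<and> c i \<noteq> 0)"
  have e: "e \<le> D" "c e \<noteq> 0"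
    using GreatestI_ex_nat[of "\<lambda>i. i \<le> D \<and> c i \<noteq> 0" D] c unfolding e_def by auto
  have e_max: "i \<le> e" if "i \<le> D" "c i \<noteq> 0" for i
    using Greatest_le_nat[of "\<lambda>i. i \<le> D \<and> c i \<noteq> 0" i D] that unfolding e_def by auto
  define u where "u = D - e + k * e"
  have "N p = {0}" if p: "p \<ge> p\<^sub>0 + int k * int (k * e)" "p \<ge> P + int k * int u" for p
  proof -
    have "x = 0" if x: "x \<in> N p" for x
    proof -
      \<comment> \<open>Terms above \<open>e\<close> have coefficient zero by maximality of
        \<open>e\<close>; those below have degree less than \<open>k * e\<close> in \<open>a\<close>
        and are differentiated away.\<close>
      have van: "c i * of_nat (ff (k * i) (k * e)) = 0" if "i \<le> D" "i \<noteq> e" for i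
      proof (cases "c i = 0")
        case False
        then have "i < e" using e_max that by (metis le_neq_implies_less)
        then have "ff (k * i) (k * e) = 0"
          unfolding ff_def using k_pos by (auto intro!: bexI[of _ "k * i"])
        then show ?thesis by simp
      qed simp
      have "0 = (\<Sum>i\<le>D. s (c i * of_nat (ff (k * i) (k * e))) (W (k * e) i x))"
        using derived[OF p(1) x] by simp
      also have "\<dots> = (\<Sum>i\<in>{e}. s (c i * of_nat (ff (k * i) (k * e))) (W (k * e) i x))"
        by (rule sum.mono_neutral_right) (use e van in auto)
      also have "\<dots> = s (c e * of_nat (ff (k * e) (k * e))) ((z ^^ u) x)"
        by (simp add: W_def u_def)
      finally have "s (c e * of_nat (ff (k * e) (k * e))) ((z ^^ u) x) = 0" by simp
      \<comment> \<open>This is the factorial of \<open>k * e\<close>, which stays nonzero in the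
        field because the characteristic is zero.\<close>
      moreover have "ff (k * e) (k * e) \<noteq> 0" unfolding ff_def by auto
      ultimately have "(z ^^ u) x = 0" using e(2) by simp
      then show "x = 0" using zpow_inj[OF p(2) x] by simp
    qed
    then show ?thesis using subspace_0[OF N_subspace] by blast
  qed
  then show ?thesis
    by (metis max.bounded_iff)
qed

end

section \<open>Homogeneous components, directness and generation in degree \<open>-1\<close>\<close>

section \<open>Graded Lie algebras\<close>

lemma (in vector_space) mem_span_UN_subspaces:
  assumes sub: "\<And>i. subspace (H i)" and x: "x \<in> span (\<Union>i. H i)"
  obtains P h where "finite P" "\<And>i. h i \<in> H i" "x = (\<Sum>i\<in>P. h i)"
proof -
  have "\<exists>P h. finite P \<and> (\<forall>i. h i \<in> H i) \<and> x = (\<Sum>i\<in>P. h i)"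
    using x
  proof (induction rule: span_induct_alt)
    case base
    have "finite ({}::'c set) \<and> (\<forall>i. (\<lambda>i. 0) i \<in> H i) \<and> 0 = (\<Sum>i\<in>{}. (\<lambda>i. 0) i)"
      using sub subspace_0 by auto
    then show ?case by (intro exI[of _ "{}"] exI[of _ "\<lambda>i. 0"])
  next
    case (step c x y)
    obtain i where i: "x \<in> H i" using step by blast
    obtain P h where Ph: "finite P" "\<forall>i. h i \<in> H i" "y = (\<Sum>i\<in>P. h i)" using step by blast
    define h' where "h' j = (if j = i then scale c x else 0) + (if j \<in> P then h j else 0)" for j
    have "\<forall>j. h' j \<in> H j"
      using i Ph sub by (auto simp: h'_def intro!: subspace_add subspace_scale subspace_0)
    moreover have "(\<Sum>j\<in>insert i P. h' j) = scale c x + y"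
    proof -
      have "(\<Sum>j\<in>insert i P. if j \<in> P then h j else 0) = (\<Sum>j\<in>P. h j)"
        using Ph(1) by (simp add: sum.If_cases Int_absorb1 subset_insertI)
      moreover have "(\<Sum>j\<in>insert i P. if j = i then scale c x else 0) = scale c x"
        using Ph(1) by (simp add: sum.delta)
      ultimately show ?thesis using Ph(3) unfolding h'_def sum.distrib by simp
    qed
    ultimately have "finite (insert i P) \<and> (\<forall>j. h' j \<in> H j) \<and> scale c x + y = (\<Sum>j\<in>insert i P. h' j)"
      using Ph(1) by simp
    then show ?case by (intro exI[of _ "insert i P"] exI[of _ h'])
  qed
  then show thesis using that by blast
qed

lemma (in vector_space) subspace_of_finite_span:
  assumes "subspace W" "finite B" "W \<subseteq> span B"
  obtains A where "finite A" "A \<subseteq> W" "span A = W"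
proof -
  obtain A where A: "A \<subseteq> W" "independent A" "W \<subseteq> span A"
    using maximal_independent_subset by blast
  then have "finite A" using independent_span_bound[OF assms(2)] assms(3) by blast
  moreover have "span A = W" using A assms(1) span_minimal by blast
  ultimately show thesis using that A(1) by blast
qed

text \<open>The bracket is bilinear on the whole type, but alternating and Jacobi only on the sum of
  the components: this is what survives when a bracket given on a carrier is extended to the ambient
  space.\<close>

locale graded_lie =
  vector_space s for s :: "'k::field \<Rightarrow> 'a::ab_group_add \<Rightarrow> 'a" +
  fixes br :: "'a \<Rightarrow> 'a \<Rightarrow> 'a" and G :: "int \<Rightarrow> 'a set"
  assumes br_add_left: "br (x + y) w = br x w + br y w"
    and br_add_right: "br w (x + y) = br w x + br w y"
    and br_scale_left: "br (s c x) w = s c (br x w)"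
    and br_scale_right: "br w (s c x) = s c (br w x)"
    and G_subspace: "subspace (G p)"
    and G_direct: "finite P \<Longrightarrow> (\<And>p. p \<in> P \<Longrightarrow> h p \<in> G p) \<Longrightarrow> (\<Sum>p\<in>P. h p) = 0 \<Longrightarrow> p \<in> P \<Longrightarrow> h p = 0"
    and br_G: "x \<in> G p \<Longrightarrow> y \<in> G q \<Longrightarrow> br x y \<in> G (p + q)"
    and br_self: "x \<in> span (\<Union>p. G p) \<Longrightarrow> br x x = 0"
    and jacobi: "x \<in> span (\<Union>p. G p) \<Longrightarrow> y \<in> span (\<Union>p. G p) \<Longrightarrow> w \<in> span (\<Union>p. G p) \<Longrightarrow>
      br x (br y w) + br y (br w x) + br w (br x y) = 0"
begin

abbreviation U where "U \<equiv> span (\<Union>p. G p)"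

lemma G_U: "x \<in> G p \<Longrightarrow> x \<in> U"
  by (auto intro: span_base)

lemma linear_br_left: "Vector_Spaces.linear s s (\<lambda>x. br x w)"
  unfolding Vector_Spaces.linear_iff using br_add_left br_scale_left vector_space_axioms by blast

lemma br_0_left [simp]: "br 0 w = 0"
  using br_add_left[of 0 0 w] by simp

lemma br_0_right [simp]: "br w 0 = 0"
  using br_add_right[of w 0 0] by simp

lemma br_minus_right: "br w (- x) = - br w x"
  using br_add_right[of w x "- x"] by (simp add: eq_neg_iff_add_eq_0 add.commute)

lemma br_span:
  assumes W: "subspace W" and AB: "\<And>x y. x \<in> A \<Longrightarrow> y \<in> B \<Longrightarrow> br x y \<in> W"
    and x: "x \<in> span A" and y: "y \<in> span B"
  shows "br x y \<in> W"
proof -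
  have 1: "br x y \<in> W" if "x \<in> A" for x
    using y
  proof (induction rule: span_induct_alt)
    case base
    show ?case using subspace_0[OF W] by simp
  next
    case (step c u v)
    then show ?case
      using AB[OF that] by (simp add: br_add_right br_scale_right subspace_add subspace_scale W)
  qed
  show ?thesis
    using x
  proof (induction rule: span_induct_alt)
    case base
    show ?case using subspace_0[OF W] by simp
  next
    case (step c u v)
    then show ?case
      using 1 by (simp add: br_add_left br_scale_left subspace_add subspace_scale W)
  qed
qed

lemma br_U: "x \<in> U \<Longrightarrow> y \<in> U \<Longrightarrow> br x y \<in> U"
  by (rule br_span[OF subspace_span]) (auto intro: span_base br_G)

lemma br_commute: "x \<in> U \<Longrightarrow> y \<in> U \<Longrightarrow> br x y = - br y x"
  using br_self[of "x + y"] br_self[of x] br_self[of y] span_add[of x _ y]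
  by (simp add: br_add_left br_add_right eq_neg_iff_add_eq_0 add.commute)

lemma br_derivation:
  assumes "x \<in> U" "y \<in> U" "w \<in> U"
  shows "br x (br y w) = br (br x y) w + br y (br x w)"
proof -
  have "br y (br w x) = - br y (br x w)"
    using br_commute[of w x] assms by (simp add: br_minus_right)
  moreover have "br w (br x y) = - br (br x y) w"
    using br_commute[of w "br x y"] assms br_U by simp
  ultimately have "br x (br y w) - br y (br x w) - br (br x y) w = 0"
    using jacobi[OF assms] by simp
  then show ?thesis by (simp add: algebra_simps)
qed

text \<open>By directness, two decompositions of one vector, into the \<open>x p\<close> and into
  members of the \<open>H i\<close>, agree degree by degree.\<close>

lemma component_mem:
  assumes H: "\<And>p. subspace (H p)" "\<And>p. H p \<subseteq> G p"
    and P: "finite P" "\<And>p. p \<in> P \<Longrightarrow> x p \<in> G p" "(\<Sum>p\<in>P. x p) \<in> span (\<Union>p. H p)"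
    and p: "p \<in> P"
  shows "x p \<in> H p"
proof -
  obtain Q h where Q: "finite Q" "\<And>i. h i \<in> H i" "(\<Sum>p\<in>P. x p) = (\<Sum>i\<in>Q. h i)"
    using mem_span_UN_subspaces[OF H(1) P(3)] by metis
  define d where "d q = (if q \<in> P then x q else 0) - (if q \<in> Q then h q else 0)" for q
  have "(\<Sum>q\<in>P \<union> Q. d q) = 0"
  proof -
    have "(\<Sum>q\<in>P \<union> Q. if q \<in> P then x q else 0) = (\<Sum>q\<in>P. x q)"
      using P(1) Q(1) by (intro sum.mono_neutral_cong_right) auto
    moreover have "(\<Sum>q\<in>P \<union> Q. if q \<in> Q then h q else 0) = (\<Sum>q\<in>Q. h q)"
      using P(1) Q(1) by (intro sum.mono_neutral_cong_right) auto
    ultimately show ?thesis using Q(3) by (simp add: d_def sum_subtractf)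
  qed
  moreover have "d q \<in> G q" for q
    unfolding d_def using P(2) Q(2) H(2) G_subspace
    by (auto intro!: subspace_diff subspace_0 subspace_neg)
  ultimately have "d p = 0"
    using G_direct[of "P \<union> Q" d p] P(1) Q(1) p by simp
  then have "x p = (if p \<in> Q then h p else 0)" using p by (simp add: d_def)
  then show ?thesis using Q(2) subspace_0[OF H(1)] by auto
qed

lemma component_mem_single:
  assumes "\<And>p. subspace (H p)" "\<And>p. H p \<subseteq> G p" "x \<in> G p" "x \<in> span (\<Union>p. H p)"
  shows "x \<in> H p"
  using component_mem[of H "{p}" "\<lambda>_. x" p] assms by auto

text \<open>Each element of the finite set \<open>B\<close> involves finitely many degrees, and a
  component outside all of them meets the span only in zero.\<close>

lemma finite_span_bounded:
  assumes "finite B" "U = span B"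
  shows "\<exists>Q. \<forall>p\<ge>Q. G p = {0}"
proof -
  have "\<exists>P. finite P \<and> b \<in> span (\<Union>p\<in>P. G p)" if b: "b \<in> B" for b
  proof -
    have "b \<in> U" using b assms span_base by blast
    then obtain P h where Ph: "finite P" "\<And>i. h i \<in> G i" "b = (\<Sum>i\<in>P. h i)"
      by (rule mem_span_UN_subspaces[OF G_subspace]) blast
    have "b \<in> span (\<Union>p\<in>P. G p)"
      unfolding Ph(3) by (intro span_sum span_base) (use Ph(2) in blast)
    then show ?thesis using Ph(1) by blast
  qed
  then obtain P where P: "\<And>b. b \<in> B \<Longrightarrow> finite (P b) \<and> b \<in> span (\<Union>p\<in>P b. G p)" by metis
  define R where "R = (\<Union>b\<in>B. P b)"
  have R: "finite R" unfolding R_def using assms P by auto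
  define H where "H p = (if p \<in> R then G p else {0})" for p
  have "span (\<Union>p\<in>P b. G p) \<subseteq> span (\<Union>p. H p)" if "b \<in> B" for b
    by (rule span_mono) (use that in \<open>auto simp: H_def R_def\<close>)
  then have "B \<subseteq> span (\<Union>p. H p)" using P by blast
  then have U: "U \<subseteq> span (\<Union>p. H p)" using assms span_minimal by blast
  have H: "subspace (H p)" "H p \<subseteq> G p" for p
    using G_subspace[of p] by (auto simp: H_def subspace_0)
  have "G p = {0}" if "p \<ge> Max (insert 0 R) + 1" for p
  proof -
    have "p \<notin> R" using Max_ge[OF finite.insertI[OF R], of p 0] that by fastforce
    then have "G p \<subseteq> {0}" using component_mem_single[OF H, of _ p] U G_U by (auto simp: H_def)
    then show ?thesis using subspace_0[OF G_subspace] by blast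
  qed
  then show ?thesis by blast
qed

text \<open>Right-nested brackets \<open>br v\<^sub>1 (br v\<^sub>2 (br v\<^sub>3 \<dots>))\<close> of elements of degree \<open>-1\<close> span a subalgebra, by induction
  on the length and the Jacobi identity; it is graded, so it can be compared with \<open>G\<close> degree by degree.\<close>

lemma generated_components:
  assumes gen: "\<And>S. subspace S \<Longrightarrow> G (-1) \<subseteq> S \<Longrightarrow> S \<subseteq> U \<Longrightarrow>
      (\<And>x y. x \<in> S \<Longrightarrow> y \<in> S \<Longrightarrow> br x y \<in> S) \<Longrightarrow> S = U"
    and j: "j \<ge> 1"
  shows "G (- int (Suc j)) \<subseteq> span {br v y | v y. v \<in> G (-1) \<and> y \<in> G (- int j)}"
proof -
  \<comment> \<open>\<open>H n\<close> is spanned by nested brackets of \<open>n + 1\<close>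
    elements, hence sits in degree \<open>- (n + 1)\<close>.\<close>
  define H where "H = rec_nat (G (-1)) (\<lambda>_ A. span {br v y | v y. v \<in> G (-1) \<and> y \<in> A})"
  have H0: "H 0 = G (-1)" and HS: "H (Suc n) = span {br v y | v y. v \<in> G (-1) \<and> y \<in> H n}" for n
    by (simp_all add: H_def)
  have H_sub: "subspace (H n)" for n
    by (cases n) (simp_all add: H0 HS G_subspace)
  have H_G: "H n \<subseteq> G (- int (Suc n))" for n
  proof (induction n)
    case (Suc n)
    have "{br v y | v y. v \<in> G (-1) \<and> y \<in> H n} \<subseteq> G (- int (Suc (Suc n)))"
    proof clarify
      fix v y assume vy: "v \<in> G (-1)" "y \<in> H n"
      then have "br v y \<in> G (-1 + - int (Suc n))" using Suc by (blast intro: br_G)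
      moreover have "-1 + - int (Suc n) = - int (Suc (Suc n))" by simp
      ultimately show "br v y \<in> G (- int (Suc (Suc n)))" by metis
    qed
    then show ?case unfolding HS by (rule span_minimal[OF _ G_subspace])
  qed (simp add: H0)
  have H_br: "br x w \<in> H (Suc (m + n))" if "x \<in> H m" "w \<in> H n" for m n x w
    using that
  proof (induction m arbitrary: n x w)
    case 0
    then show ?case unfolding add_0 HS H0 by (blast intro: span_base)
  next
    case (Suc m)
    have "br x w \<in> H (Suc (Suc m + n))" if x: "x \<in> {br v y | v y. v \<in> G (-1) \<and> y \<in> H m}" for x
    proof -
      obtain v y where vy: "x = br v y" "v \<in> G (-1)" "y \<in> H m" using x by blast
      have "y \<in> U" "v \<in> U" "w \<in> U" using vy H_G Suc.prems(2) G_U by blast+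
      \<comment> \<open>The Jacobi identity moves the outer \<open>v\<close> off \<open>x\<close>.
        What remains are brackets with \<open>y\<close> in \<open>H m\<close>, covered by the
        induction hypothesis for arbitrary \<open>n\<close>.\<close>
      then have "br x w = br v (br y w) - br y (br v w)"
        using br_derivation[of v y w] vy(1) by simp
      moreover have "br v (br y w) \<in> H (Suc (Suc m + n))"
        using Suc.IH[OF vy(3) Suc.prems(2)] vy(2) unfolding add_Suc HS[of "Suc (m + n)"]
        by (blast intro: span_base)
      moreover have "br v w \<in> H (Suc n)" using vy(2) Suc.prems(2) unfolding HS by (blast intro: span_base)
      then have "br y (br v w) \<in> H (Suc (m + Suc n))" by (rule Suc.IH[OF vy(3)])
      ultimately show ?thesis using subspace_diff[OF H_sub] by simp
    qed
    note 1 = this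
    have "x \<in> span {br v y | v y. v \<in> G (-1) \<and> y \<in> H m}"
      using Suc.prems(1) by (simp add: HS)
    moreover have "w \<in> span {w}" by (simp add: span_base)
    ultimately show ?case
      by (rule br_span[OF H_sub, rotated]) (use 1 in blast)
  qed
  define S where "S = span (\<Union>n. H n)"
  have "S = U"
  proof (rule gen)
    show "G (-1) \<subseteq> S" unfolding S_def H0[symmetric] by (blast intro: span_base)
    show "S \<subseteq> U" unfolding S_def by (rule span_minimal) (use H_G G_U in blast)+
    show "br x y \<in> S" if "x \<in> S" "y \<in> S" for x y
      unfolding S_def
      by (rule br_span[OF subspace_span _ that[unfolded S_def]]) (use H_br in \<open>blast intro: span_base\<close>)
  qed (simp add: S_def)
  \<comment> \<open>\<open>K\<close> reindexes the \<open>H n\<close> by degree, so that they can be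
    compared with \<open>G\<close>.\<close>
  define K where "K p = (if p < 0 then H (nat (- p) - 1) else {0})" for p
  have K: "subspace (K p)" "K p \<subseteq> G p" for p
  proof -
    show "subspace (K p)" by (simp add: K_def H_sub)
    show "K p \<subseteq> G p"
      using H_G[of "nat (- p) - 1"] subspace_0[OF G_subspace] by (auto simp: K_def)
  qed
  have "H n \<subseteq> K (- int (Suc n))" for n by (simp add: K_def nat_add_distrib)
  then have "S \<subseteq> span (\<Union>p. K p)" unfolding S_def by (intro span_mono) blast
  then have "G (- int (Suc j)) \<subseteq> K (- int (Suc j))"
    using component_mem_single[OF K] \<open>S = U\<close> G_U by blast
  also have "K (- int (Suc j)) = H (Suc (j - 1))" using j by (simp add: K_def nat_add_distrib)
  also have "\<dots> \<subseteq> span {br v y | v y. v \<in> G (-1) \<and> y \<in> G (- int j)}"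
    unfolding HS using H_G[of "j - 1"] j by (intro span_mono) auto
  finally show ?thesis .
qed

end

section \<open>Centralisers of the low-degree components and the propagation of their
  vanishing\<close>

section \<open>Effective graded Lie algebras\<close>

text \<open>An abstraction of effective prolongations of cofinite quotients:
  \<open>generated\<close> records generation by degree \<open>-1\<close> one step at a time, and
  \<open>depth\<close> records cofiniteness.\<close>

locale effective_graded_lie = graded_lie s br G
  for s :: "'k::field_char_0 \<Rightarrow> 'a::ab_group_add \<Rightarrow> 'a" and br G +
  fixes \<mu> :: nat
  assumes generated: "j \<ge> 1 \<Longrightarrow>
      G (- int (Suc j)) \<subseteq> span {br v y | v y. v \<in> G (-1) \<and> y \<in> G (- int j)}"
    and finite_G_minus_1: "\<exists>A. finite A \<and> span A = G (-1)"
    and effective: "p \<ge> 0 \<Longrightarrow> x \<in> G p \<Longrightarrow> (\<And>y. y \<in> G (-1) \<Longrightarrow> br x y = 0) \<Longrightarrow> x = 0"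
    and depth: "p < - int \<mu> \<Longrightarrow> G p = {0}"
begin

lemma finite_G_neg: "\<exists>A. finite A \<and> span A = G (- int (Suc j))"
proof (induction j)
  case 0
  show ?case using finite_G_minus_1 by simp
next
  case (Suc j)
  obtain A where A: "finite A" "span A = G (-1)" using finite_G_minus_1 by metis
  obtain B where B: "finite B" "span B = G (- int (Suc j))" using Suc by metis
  define E where "E = (\<lambda>(v, y). br v y) ` (A \<times> B)"
  have "{br v y | v y. v \<in> G (-1) \<and> y \<in> G (- int (Suc j))} \<subseteq> span E"
  proof clarify
    fix v y assume "v \<in> G (-1)" "y \<in> G (- int (Suc j))"
    then have "v \<in> span A" "y \<in> span B" by (simp_all add: A(2) B(2))
    moreover have "br v y \<in> span E" if "v \<in> A" "y \<in> B" for v y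
      using that unfolding E_def by (intro span_base) force
    ultimately show "br v y \<in> span E" by (rule br_span[OF subspace_span, rotated])
  qed
  then have "G (- int (Suc (Suc j))) \<subseteq> span E"
    using generated[of "Suc j"] span_minimal[OF _ subspace_span] by (metis (lifting) le_add1 order.trans plus_1_eq_Suc)
  moreover have "finite E" using A B by (simp add: E_def)
  ultimately show ?case using subspace_of_finite_span[OF G_subspace] by metis
qed

text \<open>Negative components are finitely spanned by generation. From degree \<open>-1\<close>
  upwards, effectiveness makes an element determined by its brackets with a finite spanning set of
  \<open>G (-1)\<close>, which land one degree lower.\<close>

lemma finite_G: "\<exists>A. finite A \<and> span A = G p"
proof -
  \<comment> \<open>The shift by one starts the induction at degree \<open>-1\<close>.\<close>
  have "\<exists>A. finite A \<and> span A = G (int n - 1)" for n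
  proof (induction n)
    case 0
    then show ?case using finite_G_minus_1 by simp
  next
    case (Suc n)
    obtain E where E: "finite E" "span E = G (-1)" using finite_G_minus_1 by metis
    obtain B where B: "finite B" "span B = G (int n - 1)" using Suc by metis
    have E_G: "e \<in> G (-1)" if "e \<in> E" for e using that E span_base by blast
    obtain A where "finite A" "A \<subseteq> G (int n)" "span A = G (int n)"
    proof (rule finite_span_jointly_injective[OF G_subspace E(1) linear_br_left B(1)])
      show "br x e \<in> span B" if "e \<in> E" "x \<in> G (int n)" for e x
        using br_G[OF that(2) E_G[OF that(1)]] B(2) by simp
    next
      fix x assume x: "x \<in> G (int n)" "\<And>e. e \<in> E \<Longrightarrow> br x e = 0"
      have "br x y = 0" if "y \<in> G (-1)" for y
        using br_span[of "{0}" "{x}" E x y] x that E(2) span_base[of x "{x}"] by auto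
      then show "x = 0" using effective[OF _ x(1)] by simp
    qed
    then show ?case by auto
  qed
  then show ?thesis
  proof (cases "p \<ge> -1")
    case True
    then have "p = int (nat (p + 1)) - 1" by simp
    then show ?thesis using \<open>\<And>n. \<exists>A. finite A \<and> span A = G (int n - 1)\<close> by metis
  next
    case False
    then have "p = - int (Suc (nat (- p - 1)))" by simp
    then show ?thesis using finite_G_neg by metis
  qed
qed

definition C :: "nat \<Rightarrow> int \<Rightarrow> 'a set" where
  "C k p = {x \<in> G p. \<forall>q\<le>- int k. \<forall>y\<in>G q. br x y = 0}"

lemma C_subspace: "subspace (C k p)"
  by (rule subspaceI)
    (auto simp: C_def br_add_left br_scale_left intro: subspace_0 subspace_add subspace_scale G_subspace)

text \<open>Since \<open>br w y\<close> has degree at most \<open>-k\<close>, it is killed by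
  \<open>x\<close> and the Jacobi identity loses a term. The bound on \<open>q\<close> also admits
  degree \<open>-k + 1\<close>, just above the components that \<open>x\<close> centralises.\<close>

lemma br_br_C:
  assumes x: "x \<in> C k p" and w: "w \<in> G r" and r: "r < 0" and y: "y \<in> G q" "q - 1 \<le> - int k"
  shows "br (br w x) y = br w (br x y)"
proof -
  have "br w y \<in> G (r + q)" using w y by (blast intro: br_G)
  moreover have "r + q \<le> - int k" using r y(2) by linarith
  ultimately have "br x (br w y) = 0" using x unfolding C_def by blast
  moreover have "x \<in> U" "w \<in> U" "y \<in> U" using x w y G_U unfolding C_def by blast+
  ultimately show ?thesis using br_derivation[of w x y] by simp
qed

text \<open>The ideal \<open>C (k + 1)\<close> is a module over the degree \<open>-k\<close> elements \<open>z = br v y\<close>, with \<open>v\<close> and \<open>y\<close>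
  of degrees \<open>-1\<close> and \<open>-k + 1\<close>, and \<open>z\<close> acts centrally. Removing the conditions \<open>br z x = 0\<close> that
  cut \<open>C k\<close> out of \<open>C (k + 1)\<close> one at a time, each removal is a module over the Heisenberg algebra
  spanned by \<open>v\<close>, \<open>y\<close> and \<open>z\<close>.\<close>

lemma C_Suc_eventually_zero:
  assumes k: "k \<ge> 2" and Ck: "\<exists>Q. \<forall>p\<ge>Q. C k p = {0}"
  shows "\<exists>Q. \<forall>p\<ge>Q. C (Suc k) p = {0}"
proof -
  define brs where "brs = {br v y | v y. v \<in> G (-1) \<and> y \<in> G (- int (k - 1))}"
  have brs_G: "brs \<subseteq> G (- int k)"
  proof
    fix x assume "x \<in> brs"
    then have "x \<in> G (-1 + - int (k - 1))" unfolding brs_def using br_G by blast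
    moreover have "-1 + - int (k - 1) = - int k" using k by simp
    ultimately show "x \<in> G (- int k)" by metis
  qed
  \<comment> \<open>A basis of \<open>G (- int k)\<close> made of brackets, so that each member is
    the central element of a Heisenberg triple.\<close>
  obtain Z where Z: "Z \<subseteq> brs" "independent Z" "brs \<subseteq> span Z"
    using maximal_independent_subset by blast
  obtain A where A: "finite A" "span A = G (- int k)" using finite_G by metis
  have Z_fin: "finite Z"
    using independent_span_bound[OF A(1) Z(2)] Z(1) brs_G A(2) by blast
  have "G (- int k) \<subseteq> span brs"
    using generated[of "k - 1"] k unfolding brs_def by simp
  then have Z_span: "G (- int k) \<subseteq> span Z"
    using Z(3) span_minimal[OF Z(3) subspace_span] by blast
  \<comment> \<open>\<open>D T\<close> interpolates between \<open>C (Suc k)\<close>, for empty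
    \<open>T\<close>, and a subspace of \<open>C k\<close>, for \<open>T = Z\<close>.\<close>
  define D where "D T p = {x \<in> C (Suc k) p. \<forall>t\<in>T. br x t = 0}" for T p
  have D_subspace: "subspace (D T p)" for T p
    by (rule subspaceI)
      (auto simp: D_def br_add_left br_scale_left intro: subspace_0 subspace_add subspace_scale C_subspace)
  have D_C: "x \<in> C (Suc k) p" if "x \<in> D T p" for x T p using that unfolding D_def by blast
  have D_G: "x \<in> G p" if "x \<in> D T p" for x T p using that unfolding D_def C_def by blast
  have D_br: "br w x \<in> D T (p + r)" if x: "x \<in> D T p" and w: "w \<in> G r" "r < 0" and T: "T \<subseteq> Z" for x T p w r
  proof -
    have "br w x \<in> G (p + r)" using br_G[OF w(1) D_G[OF x]] by (simp add: add.commute)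
    moreover have "br (br w x) y = 0" if "q \<le> - int (Suc k)" "y \<in> G q" for q y
    proof -
      have "br (br w x) y = br w (br x y)" by (rule br_br_C[OF D_C[OF x] w that(2)]) (use that in simp)
      also have "br x y = 0" using D_C[OF x] that unfolding C_def by blast
      finally show ?thesis by simp
    qed
    moreover have "br (br w x) t = 0" if "t \<in> T" for t
    proof -
      have "t \<in> G (- int k)" using that T Z(1) brs_G by blast
      then have "br (br w x) t = br w (br x t)" by (rule br_br_C[OF D_C[OF x] w]) simp
      also have "br x t = 0" using x that unfolding D_def by blast
      finally show ?thesis by simp
    qed
    ultimately show ?thesis unfolding D_def C_def by blast
  qed
  \<comment> \<open>Induction on the set \<open>T\<close> of conditions that are dropped; at
    \<open>T = Z\<close> none is left.\<close>
  have "\<exists>Q. \<forall>p\<ge>Q. D (Z - T) p = {0}" if "T \<subseteq> Z" for T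
    using finite_subset[OF that Z_fin] that
  proof (induction T rule: finite_induct)
    case empty
    have "D Z p \<subseteq> C k p" for p
    proof
      fix x assume x: "x \<in> D Z p"
      have "br x y = 0" if "q \<le> - int k" "y \<in> G q" for q y
      proof (cases "q = - int k")
        case True
        then have "y \<in> span Z" using that Z_span by blast
        then show ?thesis
          using br_span[of "{0}" "{x}" Z x y] x span_base[of x "{x}"] by (auto simp: D_def)
      next
        case False
        then have "q \<le> - int (Suc k)" using that(1) by linarith
        then show ?thesis using that(2) D_C[OF x] unfolding C_def by blast
      qed
      then show "x \<in> C k p" using D_G[OF x] unfolding C_def by blast
    qed
    obtain Q where "\<And>p. p \<ge> Q \<Longrightarrow> C k p = {0}" using Ck by blast
    with \<open>\<And>p. D Z p \<subseteq> C k p\<close> have "D (Z - {}) p = {0}" if "p \<ge> Q" for p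
      using subspace_0[OF D_subspace, of Z p] that by fastforce
    then show ?case by blast
  next
    case (insert t T)
    obtain Q where Q: "\<And>p. p \<ge> Q \<Longrightarrow> D (Z - T) p = {0}" using insert by auto
    obtain v y where vy: "t = br v y" "v \<in> G (-1)" "y \<in> G (- int (k - 1))"
      using insert.prems Z(1) unfolding brs_def by blast
    have t_G: "t \<in> G (- int k)" using insert.prems Z(1) brs_G by blast
    define N where "N = D (Z - insert t T)"
    have N_br: "br w x \<in> N (p + r)" if "x \<in> N p" "w \<in> G r" "r < 0" for w x p r
      using that unfolding N_def by (intro D_br) auto
    have N_U: "x \<in> U" if "x \<in> N p" for x p using that D_G G_U unfolding N_def by blast
    have N_kill: "br w x = 0" if x: "x \<in> N p" and w: "w \<in> G q" "q \<le> - int (Suc k)" for x p w q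
    proof -
      have "br x w = 0" using D_C[OF x[unfolded N_def]] w unfolding C_def by blast
      then show ?thesis using br_commute[of w x] N_U[OF x] G_U[OF w(1)] by simp
    qed
    \<comment> \<open>\<open>br v\<close>, \<open>br y\<close> and \<open>br t\<close> play the
      parts of \<open>a\<close>, \<open>b\<close> and \<open>z\<close>. From degree \<open>Q\<close>
      on \<open>br t\<close> is injective on \<open>N\<close>, because its kernel satisfies the
      condition at \<open>t\<close> too and so falls under the induction hypothesis.\<close>
    interpret heisenberg_module s "br v" "br y" "br t" N k Q
    proof
      show "\<exists>A. finite A \<and> span A = N p" for p
      proof -
        obtain A where A: "finite A" "span A = G p" using finite_G by metis
        have "N p \<subseteq> span A" unfolding A N_def using D_G by blast
        then show ?thesis
          using subspace_of_finite_span[OF D_subspace A(1)] unfolding N_def by metis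
      qed
      show "subspace (N p)" for p unfolding N_def by (rule D_subspace)
      show "br v x \<in> N (p - 1)" if "x \<in> N p" for x p
        using N_br[OF that vy(2)] by simp
      show "br y x \<in> N (p - int k + 1)" if "x \<in> N p" for x p
        using N_br[OF that vy(3)] k by (simp add: of_nat_diff algebra_simps)
      show "br t x \<in> N (p - int k)" if "x \<in> N p" for x p
        using N_br[OF that t_G] k by simp
      show "br v (br y x) = br y (br v x) + br t x" if "x \<in> N p" for x p
        using br_derivation[of v y x] vy G_U N_U[OF that] by (simp add: add.commute)
      show "br v (br t x) = br t (br v x)" if "x \<in> N p" for x p
      proof -
        \<comment> \<open>The degree \<open>-k - 1\<close> is low enough for elements of
          \<open>C (Suc k)\<close> to commute with \<open>br v t\<close>; this is why
          \<open>t\<close> acts centrally.\<close>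
        have "br v t \<in> G (-1 + - int k)" using vy t_G by (blast intro: br_G)
        then have "br (br v t) x = 0" by (rule N_kill[OF that]) simp
        then show ?thesis using br_derivation[of v t x] vy(2) t_G G_U N_U[OF that] by simp
      qed
      show "br y (br t x) = br t (br y x)" if "x \<in> N p" for x p
      proof -
        have "br y t \<in> G (- int (k - 1) + - int k)" using vy t_G by (blast intro: br_G)
        then have "br (br y t) x = 0" by (rule N_kill[OF that]) (use k in simp)
        then show ?thesis using br_derivation[of y t x] vy(3) t_G G_U N_U[OF that] by simp
      qed
      show "x = 0" if "p \<ge> Q" "x \<in> N p" "br t x = 0" for p x
      proof -
        have "br x t = 0" using br_commute[of x t] G_U[OF t_G] N_U[OF that(2)] that(3) by simp
        then have "x \<in> D (Z - T) p" using that(2) unfolding N_def D_def by auto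
        then show ?thesis using Q[OF that(1)] by blast
      qed
    qed (use k in \<open>simp_all add: br_add_right br_scale_right\<close>)
    show ?case using eventually_zero unfolding N_def .
  qed
  from this[of Z] show ?thesis by (simp add: D_def)
qed

theorem eventually_zero:
  assumes "\<exists>Q. \<forall>p\<ge>Q. C 2 p = {0}"
  shows "\<exists>Q. \<forall>p\<ge>Q. G p = {0}"
proof -
  have "\<exists>Q. \<forall>p\<ge>Q. C (2 + k) p = {0}" for k
  proof (induction k)
    case (Suc k)
    then show ?case using C_Suc_eventually_zero[of "2 + k"] by simp
  qed (use assms in simp)
  \<comment> \<open>Components of degree at most \<open>- (2 + \<mu>)\<close> are zero, so the
    centralising condition is vacuous and the chain ends at \<open>G\<close>.\<close>
  moreover have "C (2 + \<mu>) p = G p" for p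
  proof -
    have "br x y = 0" if "q \<le> - int (2 + \<mu>)" "y \<in> G q" for x q y
      using that depth[of q] by simp
    then show ?thesis unfolding C_def by blast
  qed
  ultimately show ?thesis by metis
qed

lemma finite_span_U:
  assumes "\<exists>Q. \<forall>p\<ge>Q. G p = {0}"
  shows "\<exists>B. finite B \<and> span B = U"
proof -
  obtain Q where Q: "\<And>p. p \<ge> Q \<Longrightarrow> G p = {0}" using assms by blast
  obtain A where A: "\<And>p. finite (A p) \<and> span (A p) = G p" using finite_G by metis
  define B where "B = (\<Union>p\<in>{- int \<mu>..<Q}. A p)"
  have "G p \<subseteq> span B" for p
  proof (cases "p \<in> {- int \<mu>..<Q}")
    case True
    then have "span (A p) \<subseteq> span B" by (intro span_mono) (auto simp: B_def)
    then show ?thesis using A by blast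
  next
    case False
    then have "p < - int \<mu> \<or> p \<ge> Q" by auto
    then have "G p = {0}" using Q depth by blast
    then show ?thesis using span_zero by simp
  qed
  then have "(\<Union>p. G p) \<subseteq> span B" by (rule UN_least)
  then have "U \<subseteq> span B" by (rule span_minimal) simp
  moreover have "A p \<subseteq> U" for p
  proof -
    have "A p \<subseteq> G p" using A[of p] span_superset[of "A p"] by simp
    then show ?thesis using G_U by blast
  qed
  then have "B \<subseteq> U" unfolding B_def by (intro UN_least)
  then have "span B \<subseteq> U" by (rule span_minimal) simp
  moreover have "finite B" using A by (simp add: B_def)
  ultimately have "finite B \<and> span B = U" by simp
  then show ?thesis by (rule exI)
qed

end

section \<open>Realisation of graded subquotients inside \<open>'k poly\<close>\<close>

section \<open>Graded subquotients of countable dimension\<close>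

lemma vector_space_smult: "vector_space (smult :: 'k::field \<Rightarrow> 'k poly \<Rightarrow> 'k poly)"
  by unfold_locales (simp_all add: smult_add_right smult_add_left)

text \<open>A basis of \<open>J\<close> is extended by elements of the countable set
  \<open>C\<close>; the old vectors go to zero, the new ones to distinct monomials. This realises
  \<open>S\<close> modulo \<open>J\<close> in the type on which maximality is tested.\<close>

lemma (in vector_space) exists_linear_to_poly_with_kernel:
  assumes C: "countable C" and S: "S \<subseteq> span C" and J: "subspace J" "J \<subseteq> S"
  obtains \<theta> :: "'b \<Rightarrow> 'a poly" where "Vector_Spaces.linear scale smult \<theta>"
    "\<And>x. x \<in> S \<Longrightarrow> \<theta> x = 0 \<longleftrightarrow> x \<in> J"
proof -
  interpret p: vector_space "smult :: 'a \<Rightarrow> 'a poly \<Rightarrow> 'a poly" by (rule vector_space_smult)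
  interpret vp: vector_space_pair scale "smult :: 'a \<Rightarrow> 'a poly \<Rightarrow> 'a poly" ..
  obtain B\<^sub>1 where B\<^sub>1: "B\<^sub>1 \<subseteq> J" "independent B\<^sub>1" "J \<subseteq> span B\<^sub>1"
    using maximal_independent_subset by blast
  obtain B where B: "B\<^sub>1 \<subseteq> B" "B \<subseteq> B\<^sub>1 \<union> C" "independent B" "B\<^sub>1 \<union> C \<subseteq> span B"
    using maximal_independent_subset_extend[of B\<^sub>1 "B\<^sub>1 \<union> C"] B\<^sub>1(2) by blast
  define B\<^sub>2 where "B\<^sub>2 = B - B\<^sub>1"
  have "B\<^sub>2 \<subseteq> C" using B(2) unfolding B\<^sub>2_def by auto
  then have cB\<^sub>2: "countable B\<^sub>2" using C by (rule countable_subset)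
  define m where "m b = (monom 1 (to_nat_on B\<^sub>2 b) :: 'a poly)" for b
  have m_inj: "inj_on m B\<^sub>2"
    using inj_on_to_nat_on[OF cB\<^sub>2] unfolding m_def inj_on_def by (simp add: monom_eq_iff')
  obtain \<theta> where lin: "Vector_Spaces.linear scale smult \<theta>"
    and \<theta>: "\<And>b. b \<in> B \<Longrightarrow> \<theta> b = (if b \<in> B\<^sub>1 then 0 else m b)"
    using vp.linear_independent_extend[OF B(3), of "\<lambda>b. if b \<in> B\<^sub>1 then 0 else m b"] by blast
  interpret \<theta>: Vector_Spaces.linear scale smult \<theta> by (rule lin)
  have \<theta>\<^sub>2: "\<theta> b = m b" if "b \<in> B\<^sub>2" for b using \<theta> that unfolding B\<^sub>2_def by auto
  have "p.independent (\<theta> ` B\<^sub>2)"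
    unfolding p.independent_explicit_finite_subsets
  proof (intro allI impI ballI)
    fix T u v assume T: "T \<subseteq> \<theta> ` B\<^sub>2" "finite T" "(\<Sum>v\<in>T. smult (u v) v) = 0" and v: "v \<in> T"
    have mon: "\<exists>n. w = monom 1 n" if "w \<in> T" for w using that T(1) \<theta>\<^sub>2 by (auto simp: m_def)
    obtain n where n: "v = monom 1 n" using mon v by blast
    \<comment> \<open>The coefficient at the exponent of \<open>v\<close> isolates
      \<open>u v\<close>.\<close>
    have "0 = coeff (\<Sum>w\<in>T. smult (u w) w) n" using T(3) by simp
    also have "\<dots> = (\<Sum>w\<in>T. u w * coeff w n)" by (simp add: coeff_sum)
    also have "\<dots> = (\<Sum>w\<in>{v}. u w * coeff w n)"
    proof (rule sum.mono_neutral_right)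
      show "\<forall>w\<in>T - {v}. u w * coeff w n = 0"
      proof
        fix w assume "w \<in> T - {v}"
        then show "u w * coeff w n = 0" using mon[of w] n by (auto split: if_splits)
      qed
    qed (use T v in auto)
    finally show "u v = 0" by (simp add: n)
  qed
  moreover have "inj_on \<theta> B\<^sub>2" using m_inj \<theta>\<^sub>2 by (metis inj_on_cong)
  ultimately have inj: "inj_on \<theta> (span B\<^sub>2)" by (rule \<theta>.inj_on_span_independent_image)
  have zero\<^sub>1: "\<theta> x = 0" if "x \<in> span B\<^sub>1" for x
    by (rule \<theta>.eq_0_on_span[OF _ that]) (use \<theta> B(1) in auto)
  have "\<theta> x = 0 \<longleftrightarrow> x \<in> J" if x: "x \<in> S" for x
  proof
    assume "x \<in> J"
    then show "\<theta> x = 0" using zero\<^sub>1 B\<^sub>1(3) by blast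
  next
    assume 0: "\<theta> x = 0"
    have "span C \<subseteq> span B" using B(4) by (intro span_minimal) auto
    then have "x \<in> span (B\<^sub>1 \<union> B\<^sub>2)" using x S B(1) unfolding B\<^sub>2_def by (simp add: Un_absorb1 subset_iff)
    then obtain x\<^sub>1 x\<^sub>2 where x12: "x = x\<^sub>1 + x\<^sub>2" "x\<^sub>1 \<in> span B\<^sub>1" "x\<^sub>2 \<in> span B\<^sub>2"
      unfolding span_Un by blast
    then have "\<theta> x\<^sub>2 = \<theta> 0" using 0 zero\<^sub>1[OF x12(2)] by (simp add: \<theta>.add)
    then have "x\<^sub>2 = 0" using inj x12(3) span_zero[of B\<^sub>2] unfolding inj_on_def by blast
    moreover have "span B\<^sub>1 \<subseteq> J" by (rule span_minimal[OF B\<^sub>1(1) J(1)])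
    ultimately show "x \<in> J" using x12 by auto
  qed
  then show thesis by (rule that[OF lin])
qed

text \<open>\<open>H\<close> is a graded subalgebra, \<open>J\<close> a graded ideal of
  \<open>H\<close>, and \<theta> an ambient linear map that acts on the span of \<open>H\<close> as
  the projection modulo \<open>J\<close>.\<close>

locale graded_subquotient = graded_lie s br G
  for s :: "'k::field \<Rightarrow> 'a::ab_group_add \<Rightarrow> 'a" and br G +
  fixes H J :: "int \<Rightarrow> 'a set" and \<theta> :: "'a \<Rightarrow> 'k poly"
  assumes H_subspace: "subspace (H p)" and H_G: "H p \<subseteq> G p"
    and H_br: "x \<in> H p \<Longrightarrow> y \<in> H q \<Longrightarrow> br x y \<in> H (p + q)"
    and J_subspace: "subspace (J p)" and J_H: "J p \<subseteq> H p"
    and J_br: "x \<in> H p \<Longrightarrow> y \<in> J q \<Longrightarrow> br x y \<in> J (p + q)"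
    and \<theta>_linear: "Vector_Spaces.linear s smult \<theta>"
    and \<theta>_kernel: "x \<in> U \<Longrightarrow> \<theta> x = 0 \<longleftrightarrow> x \<in> span (\<Union>p. J p)"
begin

sublocale \<theta>: Vector_Spaces.linear s smult \<theta> by (rule \<theta>_linear)

abbreviation HH where "HH \<equiv> span (\<Union>p. H p)"
abbreviation JJ where "JJ \<equiv> span (\<Union>p. J p)"

definition quotient :: "('k, 'k poly) graded_lie_alg" where
  "quotient = \<lparr>carrier = \<theta> ` HH, smul = smult,
     bracket = (\<lambda>x y. \<theta> (br (inv_into HH \<theta> x) (inv_into HH \<theta> y))), component = (\<lambda>p. \<theta> ` H p)\<rparr>"

lemma quotient_simps [simp]:
  "carrier quotient = \<theta> ` HH" "smul quotient = smult" "component quotient p = \<theta> ` H p"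
  by (simp_all add: quotient_def)

lemma HH_U: "x \<in> HH \<Longrightarrow> x \<in> U"
  using span_mono[of "\<Union>p. H p" "\<Union>p. G p"] H_G by blast

lemma JJ_HH: "x \<in> JJ \<Longrightarrow> x \<in> HH"
  using span_mono[of "\<Union>p. J p" "\<Union>p. H p"] J_H by blast

lemma H_HH: "x \<in> H p \<Longrightarrow> x \<in> HH"
  by (auto intro: span_base)

lemma br_HH: "x \<in> HH \<Longrightarrow> y \<in> HH \<Longrightarrow> br x y \<in> HH"
  by (rule br_span[OF subspace_span]) (auto intro: span_base H_br)

lemma br_HH_JJ: "x \<in> HH \<Longrightarrow> y \<in> JJ \<Longrightarrow> br x y \<in> JJ"
  by (rule br_span[OF subspace_span]) (auto intro: span_base J_br)

lemma br_JJ_HH: "x \<in> JJ \<Longrightarrow> y \<in> HH \<Longrightarrow> br x y \<in> JJ"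
  using br_HH_JJ[of y x] br_commute[of x y] HH_U JJ_HH span_neg by metis

text \<open>Changing representatives alters the bracket by an element of the ideal
  \<open>JJ\<close>, so the arbitrary choice made by \<open>inv_into\<close> in
  \<open>quotient\<close> does not matter.\<close>

lemma bracket_quotient:
  assumes "x \<in> HH" "y \<in> HH"
  shows "bracket quotient (\<theta> x) (\<theta> y) = \<theta> (br x y)"
proof -
  define x' y' where "x' = inv_into HH \<theta> (\<theta> x)" and "y' = inv_into HH \<theta> (\<theta> y)"
  have x': "x' \<in> HH" "\<theta> x' = \<theta> x" and y': "y' \<in> HH" "\<theta> y' = \<theta> y"
    unfolding x'_def y'_def using assms
    by (auto intro: inv_into_into f_inv_into_f)
  have "x' - x \<in> JJ" "y' - y \<in> JJ"
    using x' y' assms \<theta>_kernel[OF HH_U] by (metis \<theta>.diff span_diff right_minus_eq)+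
  then have "br (x' - x) y' + br x (y' - y) \<in> JJ"
    using assms y' by (intro span_add br_JJ_HH br_HH_JJ)
  moreover have "br (x' - x) y' + br x (y' - y) = br x' y' - br x y"
    using br_add_left[of "x' - x" x y'] br_add_right[of x "y' - y" y] by (simp add: algebra_simps)
  ultimately have "\<theta> (br x' y' - br x y) = 0"
    using \<theta>_kernel[OF HH_U] JJ_HH by metis
  then show ?thesis unfolding quotient_def by (simp add: \<theta>.diff x'_def y'_def)
qed

lemma component_sum_quotient: "component_sum quotient P = \<theta> ` span (\<Union>p\<in>P. H p)"
proof -
  have "(\<Union>p\<in>P. \<theta> ` H p) = \<theta> ` (\<Union>p\<in>P. H p)" by blast
  then show ?thesis unfolding component_sum_def by (simp add: \<theta>.span_image)
qed

lemma lie_algebra_quotient: "lie_algebra quotient"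
  unfolding lie_algebra_def
proof (intro conjI ballI allI; (elim imageE)?)
  show "vector_space (smul quotient)" by (simp add: vector_space_smult)
  show "module.subspace (smul quotient) (carrier quotient)"
    by (simp add: \<theta>.subspace_image)
  show "bracket quotient x y \<in> carrier quotient" if "x \<in> carrier quotient" "y \<in> carrier quotient" for x y
    using that br_HH by (auto simp: bracket_quotient)
  show "bracket quotient (x + y) z = bracket quotient x z + bracket quotient y z"
    if "x \<in> carrier quotient" "y \<in> carrier quotient" "z \<in> carrier quotient" for x y z
  proof -
    obtain x' y' z' where *: "x = \<theta> x'" "y = \<theta> y'" "z = \<theta> z'" "x' \<in> HH" "y' \<in> HH" "z' \<in> HH"
      using \<open>x \<in> _\<close> \<open>y \<in> _\<close> \<open>z \<in> _\<close> by auto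
    then have "bracket quotient (\<theta> (x' + y')) (\<theta> z') = \<theta> (br x' z' + br y' z')"
      by (simp add: bracket_quotient span_add br_add_left)
    then show ?thesis using * by (simp add: bracket_quotient \<theta>.add)
  qed
  show "bracket quotient x (y + z) = bracket quotient x y + bracket quotient x z"
    if "x \<in> carrier quotient" "y \<in> carrier quotient" "z \<in> carrier quotient" for x y z
  proof -
    obtain x' y' z' where *: "x = \<theta> x'" "y = \<theta> y'" "z = \<theta> z'" "x' \<in> HH" "y' \<in> HH" "z' \<in> HH"
      using \<open>x \<in> _\<close> \<open>y \<in> _\<close> \<open>z \<in> _\<close> by auto
    then have "bracket quotient (\<theta> x') (\<theta> (y' + z')) = \<theta> (br x' y' + br x' z')"
      by (simp add: bracket_quotient span_add br_add_right)
    then show ?thesis using * by (simp add: bracket_quotient \<theta>.add)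
  qed
  show "bracket quotient (smul quotient c x) y = smul quotient c (bracket quotient x y)"
    if "x \<in> carrier quotient" "y \<in> carrier quotient" for c x y
  proof -
    obtain x' y' where *: "x = \<theta> x'" "y = \<theta> y'" "x' \<in> HH" "y' \<in> HH"
      using \<open>x \<in> _\<close> \<open>y \<in> _\<close> by auto
    then have "bracket quotient (\<theta> (s c x')) (\<theta> y') = \<theta> (s c (br x' y'))"
      by (simp add: bracket_quotient span_scale br_scale_left)
    then show ?thesis using * by (simp add: bracket_quotient \<theta>.scale)
  qed
  show "bracket quotient x (smul quotient c y) = smul quotient c (bracket quotient x y)"
    if "x \<in> carrier quotient" "y \<in> carrier quotient" for c x y
  proof -
    obtain x' y' where *: "x = \<theta> x'" "y = \<theta> y'" "x' \<in> HH" "y' \<in> HH"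
      using \<open>x \<in> _\<close> \<open>y \<in> _\<close> by auto
    then have "bracket quotient (\<theta> x') (\<theta> (s c y')) = \<theta> (s c (br x' y'))"
      by (simp add: bracket_quotient span_scale br_scale_right)
    then show ?thesis using * by (simp add: bracket_quotient \<theta>.scale)
  qed
  show "bracket quotient x x = 0" if "x \<in> carrier quotient" for x
  proof -
    obtain x' where "x = \<theta> x'" "x' \<in> HH" using \<open>x \<in> _\<close> by auto
    then show ?thesis using br_self[OF HH_U] by (simp add: bracket_quotient)
  qed
  show "bracket quotient x (bracket quotient y z) + bracket quotient y (bracket quotient z x)
      + bracket quotient z (bracket quotient x y) = 0"
    if "x \<in> carrier quotient" "y \<in> carrier quotient" "z \<in> carrier quotient" for x y z
  proof -
    obtain x' y' z' where *: "x = \<theta> x'" "y = \<theta> y'" "z = \<theta> z'" "x' \<in> HH" "y' \<in> HH" "z' \<in> HH"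
      using \<open>x \<in> _\<close> \<open>y \<in> _\<close> \<open>z \<in> _\<close> by auto
    then show ?thesis
      using jacobi[of x' y' z'] HH_U by (simp add: bracket_quotient br_HH flip: \<theta>.add)
  qed
qed

lemma graded_lie_algebra_quotient: "graded_lie_algebra quotient"
  unfolding graded_lie_algebra_def
proof (intro conjI allI impI ballI)
  show "lie_algebra quotient" by (rule lie_algebra_quotient)
  show "module.subspace (smul quotient) (component quotient p)" for p
    by (simp add: \<theta>.subspace_image H_subspace)
  show "carrier quotient = component_sum quotient UNIV"
    by (simp add: component_sum_quotient)
  show "x p = 0" if hyp: "finite P \<and> (\<forall>p\<in>P. x p \<in> component quotient p) \<and> (\<Sum>p\<in>P. x p) = 0"
    and p: "p \<in> P" for P x p
  proof -
    obtain h where h: "\<And>p. p \<in> P \<Longrightarrow> h p \<in> H p \<and> x p = \<theta> (h p)"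
      using hyp by (simp add: image_iff) metis
    have "\<theta> (\<Sum>p\<in>P. h p) = 0" using hyp h by (simp add: \<theta>.sum)
    moreover have "(\<Sum>p\<in>P. h p) \<in> U" using h H_HH HH_U by (intro span_sum) blast
    \<comment> \<open>A sum vanishing in the quotient lifts to an element of \<open>JJ\<close>, and
      directness in \<open>G\<close> puts each homogeneous lift in \<open>J\<close>.\<close>
    ultimately have "(\<Sum>p\<in>P. h p) \<in> JJ" using \<theta>_kernel by blast
    moreover have "h q \<in> G q" if "q \<in> P" for q using h[OF that] H_G[of q] by auto
    moreover have "J q \<subseteq> G q" for q using J_H H_G by (rule order.trans)
    ultimately have "h p \<in> J p"
      using hyp p by (intro component_mem[where H = J and x = h and P = P]) (auto simp: J_subspace)
    then have "\<theta> (h p) = 0"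
      using \<theta>_kernel[OF HH_U[OF H_HH], of "h p" p] J_H by (auto intro: span_base)
    then show ?thesis using h p by simp
  qed
  show "bracket quotient x y \<in> component quotient (p + q)"
    if "x \<in> component quotient p" "y \<in> component quotient q" for p q x y
    using that H_br H_HH by (auto simp: bracket_quotient)
qed

end

section \<open>The subalgebra and the ideal that yield a prolongation of the smaller
  quotient\<close>

section \<open>Prolongations\<close>

locale prolongation =
  effective_graded_lie s br G \<mu> + F: graded_lie sF brF GF
  for s :: "'k::field_char_0 \<Rightarrow> 'a::ab_group_add \<Rightarrow> 'a" and br G \<mu>
    and sF :: "'k \<Rightarrow> 'f::ab_group_add \<Rightarrow> 'f" and brF GF +
  fixes \<pi> :: "'f \<Rightarrow> 'a"
  assumes \<pi>_linear: "Vector_Spaces.linear sF s \<pi>"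
    and \<pi>_br: "x \<in> F.U \<Longrightarrow> y \<in> F.U \<Longrightarrow> \<pi> (brF x y) = br (\<pi> x) (\<pi> y)"
    and \<pi>_GF: "p < 0 \<Longrightarrow> \<pi> ` GF p = G p"
    and GF_nonneg: "p \<ge> 0 \<Longrightarrow> GF p = {0}"

text \<open>Here \<open>kernel\<close> expresses that the ideal already divided out is contained in
  \<open>K'\<close>, and \<open>K'_high\<close> that \<open>K'\<close> lives in degrees at most
  \<open>-2\<close>.\<close>

locale prolongation_ideal =
  prolongation s br G \<mu> sF brF GF \<pi>
  for s :: "'k::field_char_0 \<Rightarrow> 'a::ab_group_add \<Rightarrow> 'a" and br G \<mu>
    and sF :: "'k \<Rightarrow> 'f::ab_group_add \<Rightarrow> 'f" and brF GF \<pi> +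
  fixes K' :: "'f set"
  assumes kernel: "x \<in> F.U \<Longrightarrow> \<pi> x = 0 \<Longrightarrow> x \<in> K'"
    and K'_subspace: "F.subspace K'" and K'_graded: "K' = F.span (\<Union>p. K' \<inter> GF p)"
    and K'_ideal: "x \<in> F.U \<Longrightarrow> y \<in> K' \<Longrightarrow> brF x y \<in> K'"
    and K'_high: "p \<ge> -1 \<Longrightarrow> K' \<inter> GF p \<subseteq> {0}"
begin

sublocale \<pi>: Vector_Spaces.linear sF s \<pi> by (rule \<pi>_linear)

text \<open>Elements of nonnegative degree that annihilate all components of degree at most \<open>-2\<close>
  annihilate \<open>\<pi> K'\<close>, which is therefore an ideal of the subalgebra \<open>H\<close> although it need not be
  one of \<open>G\<close>.\<close>

definition H :: "int \<Rightarrow> 'a set" where "H p = (if p < 0 then G p else C 2 p)"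

definition J :: "int \<Rightarrow> 'a set" where "J p = \<pi> ` (K' \<inter> GF p)"

lemma C_G: "x \<in> C k p \<Longrightarrow> x \<in> G p"
  by (simp add: C_def)

lemma H_subspace: "subspace (H p)"
  by (simp add: H_def G_subspace C_subspace)

lemma H_G: "H p \<subseteq> G p"
  by (auto simp: H_def C_G)

lemma br_C_low: "x \<in> C 2 p \<Longrightarrow> y \<in> G q \<Longrightarrow> q \<le> -2 \<Longrightarrow> br x y = 0"
  by (auto simp: C_def)

lemma br_C_G:
  assumes x: "x \<in> C 2 p" and y: "y \<in> G q" and "q < 0" "p \<ge> 0"
  shows "br y x \<in> H (p + q)"
proof (cases "p + q < 0")
  case True
  then show ?thesis using br_G[OF y C_G[OF x]] by (simp add: H_def add.commute)
next
  case False
  have "br (br y x) w = 0" if "r \<le> -2" "w \<in> G r" for r w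
    using br_br_C[OF x y \<open>q < 0\<close> that(2)] br_C_low[OF x that(2,1)] that(1) by simp
  moreover have "br y x \<in> G (p + q)" using br_G[OF y C_G[OF x]] by (simp add: add.commute)
  ultimately show ?thesis using False by (simp add: H_def C_def)
qed

lemma br_C_C:
  assumes x: "x \<in> C 2 p" and y: "y \<in> C 2 q"
  shows "br x y \<in> C 2 (p + q)"
proof -
  have "br (br x y) w = 0" if "r \<le> -2" "w \<in> G r" for r w
  proof -
    have "br x (br y w) = br (br x y) w + br y (br x w)"
      using x y that C_G G_U by (intro br_derivation) blast+
    then show ?thesis using br_C_low[OF x that(2,1)] br_C_low[OF y that(2,1)] by simp
  qed
  then show ?thesis using br_G[OF C_G[OF x] C_G[OF y]] by (simp add: C_def)
qed

lemma H_br: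
  assumes x: "x \<in> H p" and y: "y \<in> H q"
  shows "br x y \<in> H (p + q)"
proof -
  have swap: "br x y = - br y x"
    using x y H_G G_U by (intro br_commute) blast+
  consider "p < 0" "q < 0" | "p < 0" "q \<ge> 0" | "p \<ge> 0" "q < 0" | "p \<ge> 0" "q \<ge> 0" by linarith
  then show ?thesis
  proof cases
    case 1
    then show ?thesis using x y br_G by (simp add: H_def)
  next
    case 2
    then show ?thesis using br_C_G[of y q x p] x y by (simp add: H_def add.commute)
  next
    case 3
    then have "br y x \<in> H (p + q)" using br_C_G[of x p y q] x y by (simp add: H_def)
    then show ?thesis unfolding swap by (rule subspace_neg[OF H_subspace])
  next
    case 4
    then show ?thesis using br_C_C x y by (simp add: H_def)
  qed
qed

lemma J_high: "p \<ge> -1 \<Longrightarrow> J p \<subseteq> {0}"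
  using K'_high[of p] by (auto simp: J_def)

lemma J_subspace: "subspace (J p)"
  unfolding J_def by (intro \<pi>.subspace_image F.subspace_inter K'_subspace F.G_subspace)

lemma J_H: "J p \<subseteq> H p"
proof (cases "p < 0")
  case True
  then show ?thesis using \<pi>_GF[OF True] by (auto simp: J_def H_def)
next
  case False
  then show ?thesis using J_high[of p] subspace_0[OF H_subspace, of p] by auto
qed

text \<open>Three causes: \<open>J\<close> is zero above degree \<open>-2\<close>; in negative
  degrees both factors lift to \<open>F\<close>, where \<open>K'\<close> is an ideal; and
  \<open>C 2\<close> annihilates everything of degree at most \<open>-2\<close>.\<close>

lemma J_br:
  assumes x: "x \<in> H p" and y: "y \<in> J q"
  shows "br x y \<in> J (p + q)"
proof -
  have y_H: "y \<in> H q" using y J_H by blast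
  have 0: "0 \<in> J (p + q)" by (rule subspace_0[OF J_subspace])
  consider "q \<ge> -1" | "p < 0" | "p \<ge> 0" "q \<le> -2" by linarith
  then show ?thesis
  proof cases
    case 1
    then show ?thesis using J_high[of q] y 0 by auto
  next
    case 2
    then obtain x' where x': "x = \<pi> x'" "x' \<in> GF p" using x \<pi>_GF[of p] by (auto simp: H_def)
    obtain y' where y': "y = \<pi> y'" "y' \<in> K'" "y' \<in> GF q" using y by (auto simp: J_def)
    have "brF x' y' \<in> K' \<inter> GF (p + q)"
      using K'_ideal[OF F.G_U[OF x'(2)] y'(2)] F.br_G[OF x'(2) y'(3)] by blast
    moreover have "br x y = \<pi> (brF x' y')"
      using \<pi>_br F.G_U x' y' by simp
    ultimately show ?thesis by (simp add: J_def)
  next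
    case 3
    then have "br x y = 0" using br_C_low[of x p y q] x y_H H_G[of q] by (auto simp: H_def)
    then show ?thesis using 0 by simp
  qed
qed

text \<open>The image of \<open>K'\<close> has preimage exactly \<open>K'\<close> because
  \<open>K'\<close> contains the kernel of \<pi>.\<close>

lemma span_J: "x \<in> F.U \<Longrightarrow> \<pi> x \<in> span (\<Union>p. J p) \<longleftrightarrow> x \<in> K'"
proof -
  assume x: "x \<in> F.U"
  have "(\<Union>p. J p) = \<pi> ` (\<Union>p. K' \<inter> GF p)" by (auto simp: J_def)
  then have "span (\<Union>p. J p) = \<pi> ` F.span (\<Union>p. K' \<inter> GF p)" by (simp only: \<pi>.span_image)
  also have "\<dots> = \<pi> ` K'" by (simp only: K'_graded[symmetric])
  finally have eq: "span (\<Union>p. J p) = \<pi> ` K'" .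
  have K'_U: "K' \<subseteq> F.U" by (subst K'_graded) (rule F.span_mono, auto)
  show ?thesis unfolding eq
  proof
    assume "\<pi> x \<in> \<pi> ` K'"
    then obtain y where y: "\<pi> x = \<pi> y" "y \<in> K'" by blast
    then have "x - y \<in> K'" using x K'_U by (intro kernel) (auto simp: \<pi>.diff intro: F.span_diff)
    then show "x \<in> K'" using F.subspace_add[OF K'_subspace _ y(2)] by force
  qed blast
qed

text \<open>Countably many components, each finitely spanned, give \<open>U\<close> countable
  dimension.\<close>

lemma exists_subquotient: "\<exists>\<theta>. graded_subquotient s br G H J \<theta>"
proof -
  obtain A where A: "\<And>p. finite (A p) \<and> span (A p) = G p" using finite_G by metis
  have "G p \<subseteq> span (\<Union>p. A p)" for p
    using span_mono[of "A p" "\<Union>p. A p"] A[of p] by auto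
  then have "(\<Union>p. G p) \<subseteq> span (\<Union>p. A p)" by (rule UN_least)
  then have "U \<subseteq> span (\<Union>p. A p)" by (rule span_minimal) simp
  moreover have "countable (\<Union>p. A p)" using A by (simp add: countable_finite)
  moreover have "J p \<subseteq> G p" for p using J_H H_G by (rule order.trans)
  then have "span (\<Union>p. J p) \<subseteq> U" by (intro span_mono UN_mono) auto
  ultimately obtain \<theta> :: "'a \<Rightarrow> 'k poly" where "Vector_Spaces.linear s smult \<theta>"
    "\<And>x. x \<in> U \<Longrightarrow> \<theta> x = 0 \<longleftrightarrow> x \<in> span (\<Union>p. J p)"
    using exists_linear_to_poly_with_kernel[of "\<Union>p. A p" U "span (\<Union>p. J p)"] by auto
  then have "graded_subquotient s br G H J \<theta>"
    by (intro graded_subquotient.intro graded_lie_axioms graded_subquotient_axioms.intro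
        H_subspace H_G H_br J_subspace J_H J_br)
  then show ?thesis by (rule exI[of _ \<theta>])
qed

text \<open>Brackets of nonnegative components with \<open>G (-1)\<close> land in degrees at least
  \<open>-1\<close>, where \<open>J\<close> vanishes; effectiveness modulo \<open>J\<close> thus
  reduces to that of \<open>G\<close>.\<close>

lemma quotient_effective:
  assumes x: "x \<in> span (\<Union>p\<in>{0..}. H p)"
    and br: "\<And>y. y \<in> G (-1) \<Longrightarrow> br x y \<in> span (\<Union>p. J p)"
  shows "x = 0"
proof -
  define H' where "H' p = (if p \<ge> 0 then H p else {0})" for p
  have "(\<Union>p\<in>{0..}. H p) \<subseteq> (\<Union>p. H' p)" by (auto simp: H'_def)
  then have "x \<in> span (\<Union>p. H' p)" using x span_mono by blast
  moreover have "subspace (H' p)" for p by (simp add: H'_def H_subspace)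
  ultimately obtain P h where P: "finite P" "\<And>p. h p \<in> H' p" "x = (\<Sum>p\<in>P. h p)"
    using mem_span_UN_subspaces[of H' x] by metis
  have h_G: "h p \<in> G p" for p
    using P(2)[of p] H_G[of p] subspace_0[OF G_subspace, of p] by (auto simp: H'_def split: if_splits)
  have "h p = 0" if p: "p \<in> P" for p
  proof (cases "p \<ge> 0")
    case True
    have "br (h p) y = 0" if y: "y \<in> G (-1)" for y
    proof -
      \<comment> \<open>Indexing by the degree of the bracket, one below that of \<open>h\<close>,
        makes \<open>component_mem\<close> applicable.\<close>
      define f where "f q = br (h (q + 1)) y" for q
      have "f (p - 1) \<in> J (p - 1)"
      proof (rule component_mem[where P = "(\<lambda>p. p - 1) ` P"])
        show "subspace (J p)" for p by (rule J_subspace)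
        show "J p \<subseteq> G p" for p using J_H H_G by (rule order.trans)
        show "finite ((\<lambda>p. p - 1) ` P)" using P(1) by simp
        show "f q \<in> G q" for q using br_G[OF h_G[of "q + 1"] y] by (simp add: f_def)
        show "p - 1 \<in> (\<lambda>p. p - 1) ` P" using p by simp
        have "(\<Sum>q\<in>(\<lambda>p. p - 1) ` P. f q) = (\<Sum>p\<in>P. br (h p) y)"
          by (subst sum.reindex) (auto simp: f_def inj_on_def)
        also have "\<dots> = br x y"
        proof -
          interpret l: Vector_Spaces.linear s s "\<lambda>x. br x y" by (rule linear_br_left)
          show ?thesis unfolding P(3) by (rule l.sum[symmetric])
        qed
        finally show "(\<Sum>q\<in>(\<lambda>p. p - 1) ` P. f q) \<in> span (\<Union>p. J p)" using br[OF y] by simp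
      qed
      then show ?thesis using J_high[of "p - 1"] True by (auto simp: f_def)
    qed
    then show ?thesis by (rule effective[OF True h_G])
  next
    case False
    then show ?thesis using P(2)[of p] by (simp add: H'_def)
  qed
  then show "x = 0" unfolding P(3) by simp
qed

end

section \<open>Total operations in place of operations on carriers\<close>

section \<open>From carriers to ambient spaces\<close>

lemma (in vector_space) projection_on_subspace:
  assumes "subspace W"
  obtains P where "Vector_Spaces.linear scale scale P" "range P \<subseteq> W" "\<And>x. x \<in> W \<Longrightarrow> P x = x"
proof -
  interpret vp: vector_space_pair scale scale ..
  show thesis
    using vp.linear_exists_left_inverse_on[OF linear_id assms, of] that by (auto simp: inj_on_def)
qed

lemma graded_lie_algebra_carrier:
  "graded_lie_algebra g \<Longrightarrow> carrier g = module.span (smul g) (\<Union>p. component g p)"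
  by (simp add: graded_lie_algebra_def component_sum_def)

text \<open>Precomposing with a linear projection onto the carrier makes the bracket bilinear on the
  whole type without changing it on the carrier.\<close>

lemma graded_lie_algebra_total_bracket:
  assumes g: "graded_lie_algebra g"
  obtains br where "graded_lie (smul g) br (component g)"
    "\<And>x y. x \<in> carrier g \<Longrightarrow> y \<in> carrier g \<Longrightarrow> br x y = bracket g x y"
proof -
  have la: "lie_algebra g" using g by (simp add: graded_lie_algebra_def)
  interpret vector_space "smul g" using la by (simp add: lie_algebra_def)
  have sub: "subspace (carrier g)" using la by (simp add: lie_algebra_def)
  obtain P where P: "Vector_Spaces.linear (smul g) (smul g) P" "range P \<subseteq> carrier g"
    "\<And>x. x \<in> carrier g \<Longrightarrow> P x = x"
    using projection_on_subspace[OF sub] by metis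
  interpret P: Vector_Spaces.linear "smul g" "smul g" P by (rule P)
  have Pc: "P x \<in> carrier g" for x using P(2) by blast
  define br where "br x y = bracket g (P x) (P y)" for x y
  have eq: "br x y = bracket g x y" if "x \<in> carrier g" "y \<in> carrier g" for x y
    using that by (simp add: br_def P(3))
  have c: "carrier g = span (\<Union>p. component g p)" by (rule graded_lie_algebra_carrier[OF g])
  have G_c: "x \<in> carrier g" if "x \<in> component g p" for x p
    unfolding c using that by (intro span_base) blast
  have "graded_lie (smul g) br (component g)"
  proof
    show "br (x + y) w = br x w + br y w" "br w (x + y) = br w x + br w y" for x y w
      using la Pc by (simp_all add: br_def P.add lie_algebra_def)
    show "br (smul g k x) w = smul g k (br x w)" "br w (smul g k x) = smul g k (br w x)" for k x w
      using la Pc by (simp_all add: br_def P.scale lie_algebra_def)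
    show "subspace (component g p)" for p using g by (simp add: graded_lie_algebra_def)
    show "h p = 0" if "finite Q" "\<And>p. p \<in> Q \<Longrightarrow> h p \<in> component g p" "(\<Sum>p\<in>Q. h p) = 0" "p \<in> Q"
      for Q h p
    proof -
      have "\<forall>P x. finite P \<and> (\<forall>p\<in>P. x p \<in> component g p) \<and> (\<Sum>p\<in>P. x p) = 0 \<longrightarrow> (\<forall>p\<in>P. x p = 0)"
        using g unfolding graded_lie_algebra_def by (elim conjE)
      from this[rule_format, of Q h p] that show ?thesis by simp
    qed
    show "br x y \<in> component g (p + q)" if "x \<in> component g p" "y \<in> component g q" for x y p q
      using g that eq[OF G_c[OF that(1)] G_c[OF that(2)]] by (simp add: graded_lie_algebra_def)
    show "br x x = 0" if "x \<in> span (\<Union>p. component g p)" for x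
      using la eq that by (simp add: lie_algebra_def flip: c)
    show "br x (br y w) + br y (br w x) + br w (br x y) = 0"
      if "x \<in> span (\<Union>p. component g p)" "y \<in> span (\<Union>p. component g p)" "w \<in> span (\<Union>p. component g p)"
      for x y w
      using la eq that by (simp add: lie_algebra_def flip: c)
  qed
  then show thesis using eq by (rule that)
qed

lemma lie_hom_extends_linearly:
  assumes g: "lie_algebra g" and h: "vector_space (smul h)" and \<phi>: "lie_hom g h \<phi>"
  obtains \<psi> where "Vector_Spaces.linear (smul g) (smul h) \<psi>" "\<And>x. x \<in> carrier g \<Longrightarrow> \<psi> x = \<phi> x"
proof -
  interpret g: vector_space "smul g" using g by (simp add: lie_algebra_def)
  interpret h: vector_space "smul h" by (rule h)
  have sub: "g.subspace (carrier g)" using g by (simp add: lie_algebra_def)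
  obtain P where P: "Vector_Spaces.linear (smul g) (smul g) P" "range P \<subseteq> carrier g"
    "\<And>x. x \<in> carrier g \<Longrightarrow> P x = x"
    using g.projection_on_subspace[OF sub] by metis
  interpret P: Vector_Spaces.linear "smul g" "smul g" P by (rule P)
  have Pc: "P x \<in> carrier g" for x using P(2) by blast
  have "Vector_Spaces.linear (smul g) (smul h) (\<lambda>x. \<phi> (P x))"
    using \<phi> Pc unfolding Vector_Spaces.linear_iff lie_hom_def
    by (simp add: P.add P.scale g.vector_space_axioms h)
  then show thesis using that[of "\<lambda>x. \<phi> (P x)"] P(3) by simp
qed

lemma negative_part_simps [simp]:
  "carrier (negative_part g) = component_sum g {..<0}"
  "smul (negative_part g) = smul g" "bracket (negative_part g) = bracket g"
  "component (negative_part g) p = (if p < 0 then component g p else {0})"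
  by (simp_all add: negative_part_def)

lemma component_sum_mono: "vector_space (smul g) \<Longrightarrow> P \<subseteq> Q \<Longrightarrow> component_sum g P \<subseteq> component_sum g Q"
proof -
  assume "vector_space (smul g)" and PQ: "P \<subseteq> Q"
  interpret vector_space "smul g" by fact
  show ?thesis unfolding component_sum_def by (rule span_mono) (use PQ in blast)
qed

lemma free_lie_algebra_generated:
  assumes "graded_free_lie_algebra sV F \<iota>"
    and "module.subspace (smul F) S" "component F (-1) \<subseteq> S" "S \<subseteq> carrier F"
    and "\<And>x y. x \<in> S \<Longrightarrow> y \<in> S \<Longrightarrow> bracket F x y \<in> S"
  shows "S = carrier F"
proof -
  have "range \<iota> \<subseteq> S" using assms(1,3) by (auto simp: graded_free_lie_algebra_def bij_betw_def)
  moreover have "\<forall>S. module.subspace (smul F) S \<and> range \<iota> \<subseteq> S \<and> S \<subseteq> carrier F \<and>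
      (\<forall>x\<in>S. \<forall>y\<in>S. bracket F x y \<in> S) \<longrightarrow> S = carrier F"
    using assms(1) unfolding graded_free_lie_algebra_def free_lie_algebra_def by (elim conjE)
  ultimately show ?thesis using assms(2,4,5) by simp
qed

text \<open>Generation is carried over from \<open>F\<close> along the projection, finite dimension
  in degree \<open>-1\<close> comes from \<open>V\<close>, and the depth from cofiniteness of
  \<open>K\<close>.\<close>

lemma effective_prolongation_total:
  fixes g :: "('k::field_char_0, 'a::ab_group_add) graded_lie_alg"
    and F :: "('k, 'f::ab_group_add) graded_lie_alg"
  assumes V: "finite_dimensional_vector_space sV BV"
    and F: "graded_free_lie_algebra sV F \<iota>"
    and K: "cofinite_ideal F K"
    and g: "effective_prolongation F K g \<pi>"
  obtains br \<mu> brF \<pi>\<^sub>0 where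
    "prolongation (smul g) br (component g) \<mu> (smul F) brF (component F) \<pi>\<^sub>0"
    "\<And>x y. x \<in> carrier g \<Longrightarrow> y \<in> carrier g \<Longrightarrow> br x y = bracket g x y"
    "\<And>x y. x \<in> carrier F \<Longrightarrow> y \<in> carrier F \<Longrightarrow> brF x y = bracket F x y"
    "\<And>x. x \<in> carrier F \<Longrightarrow> \<pi>\<^sub>0 x = \<pi> x"
proof -
  have gla: "graded_lie_algebra g" "graded_lie_algebra F"
    using g F by (simp_all add: effective_prolongation_def graded_free_lie_algebra_def)
  then have la: "lie_algebra g" "lie_algebra F" by (simp_all add: graded_lie_algebra_def)
  have quot: "is_graded_quotient F K (negative_part g) \<pi>"
    using g by (simp add: effective_prolongation_def)
  then have hom: "lie_hom F (negative_part g) \<pi>" by (simp add: is_graded_quotient_def)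
  obtain br where br: "graded_lie (smul g) br (component g)"
    "\<And>x y. x \<in> carrier g \<Longrightarrow> y \<in> carrier g \<Longrightarrow> br x y = bracket g x y"
    by (rule graded_lie_algebra_total_bracket[OF gla(1)]) blast
  obtain brF where brF: "graded_lie (smul F) brF (component F)"
    "\<And>x y. x \<in> carrier F \<Longrightarrow> y \<in> carrier F \<Longrightarrow> brF x y = bracket F x y"
    by (rule graded_lie_algebra_total_bracket[OF gla(2)]) blast
  interpret G: graded_lie "smul g" br "component g" by (rule br)
  interpret F: graded_lie "smul F" brF "component F" by (rule brF)
  obtain \<pi>\<^sub>0 where \<pi>\<^sub>0: "Vector_Spaces.linear (smul F) (smul g) \<pi>\<^sub>0" "\<And>x. x \<in> carrier F \<Longrightarrow> \<pi>\<^sub>0 x = \<pi> x"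
    using lie_hom_extends_linearly[OF la(2) _ hom] G.vector_space_axioms by auto
  interpret \<pi>\<^sub>0: Vector_Spaces.linear "smul F" "smul g" \<pi>\<^sub>0 by (rule \<pi>\<^sub>0)
  have cg: "carrier g = G.U" and cF: "carrier F = F.U"
    by (simp_all add: graded_lie_algebra_carrier gla)
  have \<pi>_c: "\<pi> x \<in> carrier g" if "x \<in> carrier F" for x
  proof -
    have "\<pi> x \<in> component_sum g {..<0}" using hom that by (auto simp: lie_hom_def)
    also have "component_sum g {..<0} \<subseteq> component_sum g UNIV"
      by (rule component_sum_mono) (auto intro: G.vector_space_axioms)
    finally show ?thesis by (simp add: cg component_sum_def)
  qed
  have \<pi>_br: "\<pi>\<^sub>0 (brF x y) = br (\<pi>\<^sub>0 x) (\<pi>\<^sub>0 y)" if "x \<in> F.U" "y \<in> F.U" for x y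
  proof -
    have xy: "x \<in> carrier F" "y \<in> carrier F" using that by (simp_all add: cF)
    have "bracket F x y \<in> carrier F" using la(2) xy by (simp add: lie_algebra_def)
    then show ?thesis
      using xy hom by (simp add: \<pi>\<^sub>0(2) br(2) brF(2) \<pi>_c lie_hom_def)
  qed
  have \<pi>_GF: "\<pi>\<^sub>0 ` component F p = component g p" if "p < 0" for p
  proof -
    have "\<pi>\<^sub>0 ` component F p = \<pi> ` component F p"
      by (intro image_cong refl \<pi>\<^sub>0(2)) (simp add: cF F.G_U)
    also have "\<dots> = component g p" using quot that by (simp add: is_graded_quotient_def)
    finally show ?thesis .
  qed
  obtain \<mu> :: int where \<mu>: "\<mu> \<ge> 1" "filtration F (\<mu> + 1) \<subseteq> K"
    using K by (auto simp: cofinite_ideal_def)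
  have gen: "component F (- int (Suc j))
      \<subseteq> F.span {brF v y | v y. v \<in> component F (-1) \<and> y \<in> component F (- int j)}" if "j \<ge> 1" for j
  proof (rule F.generated_components[OF _ that])
    fix S assume S: "F.subspace S" "component F (-1) \<subseteq> S" "S \<subseteq> F.U"
      and closed: "\<And>x y. x \<in> S \<Longrightarrow> y \<in> S \<Longrightarrow> brF x y \<in> S"
    have "bracket F x y \<in> S" if "x \<in> S" "y \<in> S" for x y
      using closed[OF that] brF(2)[of x y] that S(3) by (simp add: cF subset_iff)
    then show "S = F.U" using free_lie_algebra_generated[OF F S(1,2)] S(3) by (simp add: cF)
  qed
  have "prolongation (smul g) br (component g) (nat \<mu>) (smul F) brF (component F) \<pi>\<^sub>0"
  proof
    show "component g (- int (Suc j))
      \<subseteq> G.span {br v y | v y. v \<in> component g (-1) \<and> y \<in> component g (- int j)}" if j: "j \<ge> 1" for j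
    proof -
      have "\<pi>\<^sub>0 ` component F (- int (Suc j))
          \<subseteq> \<pi>\<^sub>0 ` F.span {brF v y | v y. v \<in> component F (-1) \<and> y \<in> component F (- int j)}"
        by (rule image_mono[OF gen[OF j]])
      also have "\<dots> = G.span (\<pi>\<^sub>0 ` {brF v y | v y. v \<in> component F (-1) \<and> y \<in> component F (- int j)})"
        by (simp only: \<pi>\<^sub>0.span_image)
      also have "\<dots> \<subseteq> G.span {br v y | v y. v \<in> component g (-1) \<and> y \<in> component g (- int j)}"
      proof (rule G.span_mono, safe)
        fix v y assume vy: "v \<in> component F (-1)" "y \<in> component F (- int j)"
        have "\<pi>\<^sub>0 v \<in> component g (-1)" using vy(1) \<pi>_GF[of "-1"] by auto
        moreover have "\<pi>\<^sub>0 y \<in> component g (- int j)" using vy(2) \<pi>_GF[of "- int j"] j by auto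
        ultimately show "\<exists>v' y'. \<pi>\<^sub>0 (brF v y) = br v' y' \<and> v' \<in> component g (-1) \<and> y' \<in> component g (- int j)"
          using \<pi>_br[OF F.G_U[OF vy(1)] F.G_U[OF vy(2)]] by metis
      qed
      finally show ?thesis using \<pi>_GF[of "- int (Suc j)"] by simp
    qed
    show "\<exists>A. finite A \<and> G.span A = component g (-1)"
    proof -
      interpret V: finite_dimensional_vector_space sV BV by (rule V)
      interpret \<iota>: Vector_Spaces.linear sV "smul F" \<iota>
        using F by (simp add: graded_free_lie_algebra_def free_lie_algebra_def)
      have "component g (-1) = \<pi>\<^sub>0 ` component F (-1)" using \<pi>_GF[of "-1"] by simp
      also have "component F (-1) = \<iota> ` V.span BV"
        using F V.span_Basis by (auto simp: graded_free_lie_algebra_def bij_betw_def)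
      finally have "component g (-1) = G.span (\<pi>\<^sub>0 ` \<iota> ` BV)"
        by (simp only: \<iota>.span_image \<pi>\<^sub>0.span_image)
      moreover have "finite (\<pi>\<^sub>0 ` \<iota> ` BV)" using V.finite_Basis by simp
      ultimately show ?thesis by metis
    qed
    show "x = 0" if p: "p \<ge> 0" and x: "x \<in> component g p"
      and 0: "\<And>y. y \<in> component g (-1) \<Longrightarrow> br x y = 0" for p x
    proof -
      have "x \<in> component_sum g {0..}"
        unfolding component_sum_def using p x by (intro G.span_base) auto
      moreover have "\<forall>y\<in>component g (-1). bracket g x y = 0"
        using 0 br(2) x by (metis G.G_U cg)
      ultimately have "x \<in> {x \<in> component_sum g {0..}. \<forall>y\<in>component g (-1). bracket g x y = 0}" by simp
      also have "\<dots> = {0}" using g by (simp add: effective_prolongation_def)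
      finally show "x = 0" by simp
    qed
    show "component g p = {0}" if "p < - int (nat \<mu>)" for p
    proof -
      have "\<pi>\<^sub>0 x = 0" if "x \<in> component F p" for x
      proof -
        \<comment> \<open>Degrees below \<open>-\<mu>\<close> are exactly those of
          \<open>filtration F (\<mu> + 1)\<close>, which dies in the quotient.\<close>
        have "p \<in> {..- (\<mu> + 1)}" using \<open>p < - int (nat \<mu>)\<close> \<mu>(1) by simp
        then have "x \<in> filtration F (\<mu> + 1)"
          unfolding filtration_def component_sum_def
          using that by (intro F.span_base UN_I)
        then have "x \<in> K" using \<mu>(2) by blast
        then show ?thesis using quot \<pi>\<^sub>0(2) by (auto simp: is_graded_quotient_def)
      qed
      then have "component g p \<subseteq> {0}" using \<pi>_GF[of p] that by auto
      then show ?thesis using G.subspace_0[OF G.G_subspace, of p] by blast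
    qed
    show "component F p = {0}" if "p \<ge> 0" for p
      using F that by (simp add: graded_free_lie_algebra_def)
  qed (simp_all add: \<pi>_br \<pi>_GF \<pi>\<^sub>0.add \<pi>\<^sub>0.scale)
  then show thesis using br(2) brF(2) \<pi>\<^sub>0(2) by (rule that)
qed

section \<open>Comparison of the two prolongations\<close>

text \<open>The quotient of \<open>H\<close> by \<open>J\<close> embeds in \<open>g'\<close>; finite
  dimension of \<open>g'\<close> then kills \<open>C 2\<close> in large degrees, and
  \<open>eventually_zero\<close> extends this to all of \<open>g\<close>.\<close>

lemma fin_dim_mono:
  fixes g :: "('k::field_char_0, 'a::ab_group_add) graded_lie_alg"
    and g' :: "('k, 'b::ab_group_add) graded_lie_alg"
    and F :: "('k, 'f::ab_group_add) graded_lie_alg"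
  assumes V: "finite_dimensional_vector_space sV BV"
    and F: "graded_free_lie_algebra sV F \<iota>"
    and K: "cofinite_ideal F K"
    and K': "graded_lie_ideal F K'" "K' \<subseteq> filtration F 2"
    and sub: "L \<subseteq> L'" "K \<subseteq> K'"
    and g: "effective_prolongation F K g \<pi>" "of_type \<iota> L g \<pi>"
    and g': "maximal_prolongation F \<iota> K' L' g' \<pi>'"
    and fin: "fin_dim g'"
  shows "fin_dim g"
proof -
  obtain br \<mu> brF \<pi>\<^sub>0 where
    prol: "prolongation (smul g) br (component g) \<mu> (smul F) brF (component F) \<pi>\<^sub>0"
    and br: "\<And>x y. x \<in> carrier g \<Longrightarrow> y \<in> carrier g \<Longrightarrow> br x y = bracket g x y"
    and brF: "\<And>x y. x \<in> carrier F \<Longrightarrow> y \<in> carrier F \<Longrightarrow> brF x y = bracket F x y"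
    and \<pi>\<^sub>0: "\<And>x. x \<in> carrier F \<Longrightarrow> \<pi>\<^sub>0 x = \<pi> x"
    by (rule effective_prolongation_total[OF V F K g(1)]) blast
  interpret prolongation "smul g" br "component g" \<mu> "smul F" brF "component F" \<pi>\<^sub>0 by (rule prol)
  have gla: "graded_lie_algebra g" "graded_lie_algebra F"
    using g(1) F by (simp_all add: effective_prolongation_def graded_free_lie_algebra_def)
  have cg: "carrier g = U" and cF: "carrier F = F.U"
    by (simp_all add: graded_lie_algebra_carrier gla)
  have quot: "is_graded_quotient F K (negative_part g) \<pi>"
    using g(1) by (simp add: effective_prolongation_def)
  have K'_lie: "lie_ideal F K'" "K' = F.span (\<Union>p. K' \<inter> component F p)"
    using K'(1) by (simp_all add: graded_lie_ideal_def)
  have K'_c: "K' \<subseteq> F.U" using K'_lie(1) by (simp add: lie_ideal_def cF)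
  interpret prolongation_ideal "smul g" br "component g" \<mu> "smul F" brF "component F" \<pi>\<^sub>0 K'
  proof
    show "x \<in> K'" if "x \<in> F.U" "\<pi>\<^sub>0 x = 0" for x
    proof -
      have "x \<in> {x \<in> carrier F. \<pi> x = 0}" using that \<pi>\<^sub>0[of x] by (simp add: cF)
      also have "\<dots> = K" using quot by (simp add: is_graded_quotient_def)
      finally show ?thesis using sub(2) by blast
    qed
    show "F.subspace K'" using K'_lie(1) by (simp add: lie_ideal_def)
    show "K' = F.span (\<Union>p. K' \<inter> component F p)" by (rule K'_lie(2))
    show "brF x y \<in> K'" if "x \<in> F.U" "y \<in> K'" for x y
      using K'_lie(1) brF[of x y] that K'_c by (auto simp: lie_ideal_def cF)
    show "K' \<inter> component F p \<subseteq> {0}" if p: "p \<ge> -1" for p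
    proof
      fix x assume x: "x \<in> K' \<inter> component F p"
      \<comment> \<open>The part of \<open>F\<close> in degrees at most \<open>-2\<close>;
        directness shows that components of higher degree meet its span only in zero.\<close>
      define M where "M q = (if q \<le> -2 then component F q else {0})" for q
      have "filtration F 2 = F.span (\<Union>q\<in>{..-2}. component F q)"
        by (simp add: filtration_def component_sum_def)
      also have "\<dots> \<subseteq> F.span (\<Union>q. M q)" by (rule F.span_mono) (auto simp: M_def)
      finally have "x \<in> F.span (\<Union>q. M q)" using x K'(2) by blast
      moreover have "F.subspace (M q)" "M q \<subseteq> component F q" for q
        using F.subspace_0[OF F.G_subspace, of q] by (auto simp: M_def F.G_subspace)
      ultimately have "x \<in> M p" using x by (intro F.component_mem_single[where H = M]) auto
      then show "x \<in> {0}" using p by (simp add: M_def)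
    qed
  qed
  obtain \<theta> where "graded_subquotient (smul g) br (component g) H J \<theta>"
    using exists_subquotient by (elim exE)
  then interpret graded_subquotient "smul g" br "component g" H J \<theta> .
  have H_neg: "H p = component g p" if "p < 0" for p using that by (simp add: H_def)
  have \<pi>_image: "\<pi> ` carrier F = span (\<Union>p\<in>{..<0}. H p)"
    using quot H_neg by (simp add: is_graded_quotient_def component_sum_def)
  have neg_HH: "span (\<Union>p\<in>{..<0}. H p) \<subseteq> HH"
    by (rule span_mono) blast
  have \<pi>_HH: "\<pi> x \<in> HH" if "x \<in> carrier F" for x
    using \<pi>_image neg_HH that by blast
  have HH_c: "x \<in> carrier g" if "x \<in> HH" for x using HH_U[OF that] by (simp add: cg)
  have \<pi>_hom: "lie_hom F (negative_part g) \<pi>" using quot by (simp add: is_graded_quotient_def)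
  have carrier_neg: "component_sum quotient {..<0} = \<theta> ` \<pi> ` carrier F"
    by (simp add: component_sum_quotient \<pi>_image)
  have "is_graded_quotient F K' (negative_part quotient) (\<lambda>x. \<theta> (\<pi> x))"
    unfolding is_graded_quotient_def
  proof (intro conjI allI)
    show "lie_hom F (negative_part quotient) (\<lambda>x. \<theta> (\<pi> x))"
      unfolding lie_hom_def
    proof (intro conjI ballI allI)
      show "(\<lambda>x. \<theta> (\<pi> x)) ` carrier F \<subseteq> carrier (negative_part quotient)"
        by (auto simp: carrier_neg)
      show "\<theta> (\<pi> (x + y)) = \<theta> (\<pi> x) + \<theta> (\<pi> y)" if "x \<in> carrier F" "y \<in> carrier F" for x y
        using \<pi>_hom that by (simp add: lie_hom_def \<theta>.add)
      show "\<theta> (\<pi> (smul F c x)) = smul (negative_part quotient) c (\<theta> (\<pi> x))" if "x \<in> carrier F" for c x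
        using \<pi>_hom that by (simp add: lie_hom_def \<theta>.scale)
      show "\<theta> (\<pi> (bracket F x y)) = bracket (negative_part quotient) (\<theta> (\<pi> x)) (\<theta> (\<pi> y))"
        if "x \<in> carrier F" "y \<in> carrier F" for x y
        using \<pi>_hom that by (simp add: lie_hom_def bracket_quotient \<pi>_HH br HH_c)
    qed
    show "(\<lambda>x. \<theta> (\<pi> x)) ` carrier F = carrier (negative_part quotient)"
      by (simp add: carrier_neg image_image)
    have "\<theta> (\<pi> x) = 0 \<longleftrightarrow> x \<in> K'" if "x \<in> carrier F" for x
      using \<theta>_kernel[OF HH_U[OF \<pi>_HH[OF that]]] span_J[of x] that \<pi>\<^sub>0[OF that] by (simp add: cF)
    then show "{x \<in> carrier F. \<theta> (\<pi> x) = 0} = K'" using K'_c by (auto simp: cF)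
    show "(\<lambda>x. \<theta> (\<pi> x)) ` component F p = component (negative_part quotient) p" for p
    proof -
      have "\<pi> ` component F p = component (negative_part g) p"
        using quot unfolding is_graded_quotient_def by (elim conjE allE)
      then have "(\<lambda>x. \<theta> (\<pi> x)) ` component F p = \<theta> ` component (negative_part g) p"
        by (metis image_image)
      then show ?thesis using H_neg by (simp add: \<theta>.zero)
    qed
  qed
  moreover have "{X \<in> component_sum quotient {0..}. \<forall>Y\<in>component quotient (-1). bracket quotient X Y = 0} = {0}"
  proof (intro equalityI subsetI)
    fix X assume "X \<in> {X \<in> component_sum quotient {0..}. \<forall>Y\<in>component quotient (-1). bracket quotient X Y = 0}"
    then obtain x where x: "X = \<theta> x" "x \<in> span (\<Union>p\<in>{0..}. H p)"
      and 0: "\<And>y. y \<in> H (-1) \<Longrightarrow> bracket quotient (\<theta> x) (\<theta> y) = 0"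
      by (auto simp: component_sum_quotient)
    have "span (\<Union>p\<in>{0..}. H p) \<subseteq> HH" by (rule span_mono) blast
    then have x_HH: "x \<in> HH" using x(2) by blast
    have "br x y \<in> JJ" if "y \<in> component g (-1)" for y
    proof -
      have y: "y \<in> H (-1)" using that by (simp add: H_def)
      then have "\<theta> (br x y) = 0" using 0 bracket_quotient[OF x_HH H_HH[OF y]] by simp
      then show ?thesis using \<theta>_kernel[OF HH_U[OF br_HH[OF x_HH H_HH[OF y]]]] by simp
    qed
    then have "x = 0" by (rule quotient_effective[OF x(2)])
    then show "X \<in> {0}" by (simp add: x(1) \<theta>.zero)
  next
    fix X :: "'k poly" assume X: "X \<in> {0}"
    have "bracket quotient 0 (\<theta> y) = 0" if "y \<in> H (-1)" for y
      using bracket_quotient[OF span_zero H_HH[OF that]] by (simp add: \<theta>.zero)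
    moreover have "\<theta> 0 \<in> component_sum quotient {0..}"
      unfolding component_sum_quotient by (intro imageI span_zero)
    ultimately show "X \<in> {X \<in> component_sum quotient {0..}. \<forall>Y\<in>component quotient (-1). bracket quotient X Y = 0}"
      using X by (simp add: \<theta>.zero)
  qed
  ultimately have eff: "effective_prolongation F K' quotient (\<lambda>x. \<theta> (\<pi> x))"
    using graded_lie_algebra_quotient by (simp add: effective_prolongation_def)
  have "of_type \<iota> L' quotient (\<lambda>x. \<theta> (\<pi> x))"
    unfolding of_type_def
  proof
    fix A assume "A \<in> component quotient 0"
    then obtain a where a: "A = \<theta> a" "a \<in> H 0" by auto
    then have "a \<in> component g 0" using H_G[of 0] by blast
    then obtain l where l: "l \<in> L" "\<And>v. bracket g a (\<pi> (\<iota> v)) = \<pi> (\<iota> (l v))"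
      using g(2) unfolding of_type_def by blast
    have \<iota>_c: "\<iota> v \<in> carrier F" for v
      using F by (auto simp: graded_free_lie_algebra_def free_lie_algebra_def)
    have "bracket quotient A (\<theta> (\<pi> (\<iota> v))) = \<theta> (\<pi> (\<iota> (l v)))" for v
    proof -
      have "bracket quotient A (\<theta> (\<pi> (\<iota> v))) = \<theta> (br a (\<pi> (\<iota> v)))"
        unfolding a(1) by (rule bracket_quotient[OF H_HH[OF a(2)] \<pi>_HH[OF \<iota>_c]])
      also have "br a (\<pi> (\<iota> v)) = \<pi> (\<iota> (l v))"
        using br[OF HH_c[OF H_HH[OF a(2)]] HH_c[OF \<pi>_HH[OF \<iota>_c]]] l(2) by simp
      finally show ?thesis .
    qed
    then show "\<exists>a\<in>L'. \<forall>v. bracket quotient A (\<theta> (\<pi> (\<iota> v))) = \<theta> (\<pi> (\<iota> (a v)))"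
      using l(1) sub(1) by blast
  qed
  \<comment> \<open>Maximality of \<open>g'\<close> is applied to the competitor
    \<open>quotient\<close>, which lives in \<open>'k poly\<close>.\<close>
  with eff have "\<exists>\<phi>. lie_hom quotient g' \<phi> \<and> inj_on \<phi> (carrier quotient) \<and>
      (\<forall>p. \<phi> ` component quotient p \<subseteq> component g' p) \<and>
      (\<forall>x\<in>carrier F. \<phi> (\<theta> (\<pi> x)) = \<pi>' x)"
    using g' unfolding maximal_prolongation_def by (elim conjE allE impE) (intro conjI)
  then obtain \<phi> where \<phi>: "lie_hom quotient g' \<phi>" "inj_on \<phi> (carrier quotient)"
    "\<And>p. \<phi> ` component quotient p \<subseteq> component g' p"
    by (elim exE conjE) blast
  have "\<exists>Q. \<forall>p\<ge>Q. component g' p = {0}"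
  proof -
    have gla': "graded_lie_algebra g'"
      using g' by (simp add: maximal_prolongation_def effective_prolongation_def)
    obtain br' where "graded_lie (smul g') br' (component g')"
      by (rule graded_lie_algebra_total_bracket[OF gla']) blast
    then interpret g': graded_lie "smul g'" br' "component g'" .
    obtain B where "finite B" "g'.U = g'.span B"
      using fin graded_lie_algebra_carrier[OF gla'] unfolding fin_dim_def by metis
    then show ?thesis by (rule g'.finite_span_bounded)
  qed
  then obtain Q where Q: "\<And>p. p \<ge> Q \<Longrightarrow> component g' p = {0}" by blast
  \<comment> \<open>The map \<phi> is additive on the carrier only, so its value at zero has to be
    derived there.\<close>
  have \<theta>0: "\<theta> 0 \<in> carrier quotient" unfolding quotient_simps by (intro imageI span_zero)
  have "\<phi> (\<theta> 0 + \<theta> 0) = \<phi> (\<theta> 0) + \<phi> (\<theta> 0)" using \<phi>(1) \<theta>0 unfolding lie_hom_def by blast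
  then have \<phi>0: "\<phi> (\<theta> 0) = 0" by (simp add: \<theta>.zero)
  have "C 2 p = {0}" if p: "p \<ge> max Q 0" for p
  proof -
    have "x = 0" if "x \<in> C 2 p" for x
    proof -
      have x: "x \<in> H p" using that p by (simp add: H_def)
      have "\<phi> (\<theta> x) \<in> component g' p" using \<phi>(3)[of p] x by auto
      then have "\<phi> (\<theta> x) = \<phi> (\<theta> 0)" using Q[of p] p \<phi>0 by simp
      moreover have "\<theta> x \<in> carrier quotient" using H_HH[OF x] by simp
      ultimately have "\<theta> x = \<theta> 0" using \<theta>0 by (rule inj_onD[OF \<phi>(2)])
      \<comment> \<open>Vanishing in the quotient means membership in \<open>J\<close>, which is
        zero in nonnegative degrees.\<close>
      then have "x \<in> JJ" using \<theta>_kernel[OF HH_U[OF H_HH[OF x]]] by (simp add: \<theta>.zero)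
      moreover have "J q \<subseteq> component g q" for q using J_H H_G by (rule order.trans)
      ultimately have "x \<in> J p"
        using x H_G[of p] by (intro component_mem_single[where H = J] J_subspace) auto
      then show "x = 0" using J_high[of p] p by auto
    qed
    then show ?thesis using subspace_0[OF C_subspace, of 2 p] by blast
  qed
  then have "\<exists>Q. \<forall>p\<ge>Q. component g p = {0}" by (intro eventually_zero exI[of _ "max Q 0"]) blast
  then show ?thesis using finite_span_U unfolding fin_dim_def by (simp add: cg)
qed

theorem proposition2p12:
  fixes sV :: "'k::field_char_0 \<Rightarrow> 'v::ab_group_add \<Rightarrow> 'v"
    and BV :: "'v set" and n :: nat
    and F :: "('k, 'f::ab_group_add) graded_lie_alg" and \<iota> :: "'v \<Rightarrow> 'f"
    and L L' :: "('v \<Rightarrow> 'v) set"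
    and K K' :: "'f set"
    and g :: "('k, 'a::ab_group_add) graded_lie_alg" and \<pi> :: "'f \<Rightarrow> 'a"
    and g' :: "('k, 'b::ab_group_add) graded_lie_alg" and \<pi>' :: "'f \<Rightarrow> 'b"
  assumes "finite_dimensional_vector_space sV BV"
    and "vector_space.dim sV (UNIV :: 'v set) = n" and "n \<ge> 2"
    and "graded_free_lie_algebra sV F \<iota>"
    and "lie_subalgebra_gl sV L" and "lie_subalgebra_gl sV L'"
    and "graded_lie_ideal F K" and "cofinite_ideal F K" and "K \<subseteq> filtration F 2"
    and "graded_lie_ideal F K'" and "cofinite_ideal F K'" and "K' \<subseteq> filtration F 2"
    and "L \<subseteq> L'" and "K \<subseteq> K'"
    and "maximal_prolongation F \<iota> K L g \<pi>"
    and "maximal_prolongation F \<iota> K' L' g' \<pi>'"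
  shows "(fin_dim g' \<longrightarrow> fin_dim g) \<and> (\<not> fin_dim g \<longrightarrow> \<not> fin_dim g')"
proof -
  have "effective_prolongation F K g \<pi>" "of_type \<iota> L g \<pi>"
    using assms(15) by (simp_all add: maximal_prolongation_def)
  \<comment> \<open>The second implication is the contrapositive of the first.\<close>
  then show ?thesis
    using fin_dim_mono[OF assms(1,4,8,10,12,13,14)] assms(16) by blast
qed

end
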